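(* Let $\lambda$ be a partition of $n$ with at most three rows or at most two columns. Suppose $w\in S_n$ is a Schubert point associated to $\lambda$ and $v\in S_n$ satisfies $v\le w$ in Bruhat order. Then $v$ is also a Schubert point associated to $\lambda$.
   Context: $S_n$ is generated by the simple transpositions $s_i=(i,i+1)$, $1\le i\le n-1$; $\le$ denotes Bruhat order. A partition $\lambda=(\lambda_1\ge\lambda_2\ge\cdots)$ of $n$ is drawn as a left-justified Young diagram whose $i$-th row from the top has $\lambda_i$ boxes. A row-strict tableau of shape $\lambda$ is a filling of the boxes by $1,\dots,n$, each used once, with entries increasing left to right in each row (no condition on columns). For a row-strict tableau $T$, a Springer dimension pair is a pair $(p,q)$ with $1\le p<q\le n$ such that (1) $q$ occurs in a box below $p$ in the same column, or in any column strictly to the left of $p$; and (2) if the box directly to the right of $p$ exists and is filled by $r_p$, then $q<r_p$. For $2\le q\le n$ let $\ell_{q-1}$ be the number of Springer dimension pairs of $T$ of the form $(p,q)$. Put $w_{q-1}=s_{q-\ell_{q-1}}s_{q-\ell_{q-1}+1}\cdots s_{q-2}s_{q-1}$ if $\ell_{q-1}\ne0$, and $w_{q-1}=e$ if $\ell_{q-1}=0$. The Schubert point of $T$ is $w_T=w_{n-1}w_{n-2}\cdots w_2w_1\in S_n$. A Schubert point associated to $\lambda$ is a permutation of the form $w_T$ for some row-strict tableau $T$ of shape $\lambda$. *)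

theory Defs
  imports "HOL-Combinatorics.Permutations"
begin

text \<open>
  Elements of the symmetric group on \<open>n\<close> letters are the functions \<open>w\<close> on the natural numbers with
  \<open>w permutes {1..n}\<close>, and the group product \<open>u v\<close> is the composition \<open>u \<circ> v\<close>.
\<close>

definition simple_transp :: "nat \<Rightarrow> nat \<Rightarrow> nat" where
  "simple_transp i = Transposition.transpose i (Suc i)"

definition perm_of_word :: "nat list \<Rightarrow> nat \<Rightarrow> nat" where
  "perm_of_word is = foldr (\<lambda>i u. simple_transp i \<circ> u) is id"

definition coxeter_length :: "nat \<Rightarrow> (nat \<Rightarrow> nat) \<Rightarrow> nat" where
  "coxeter_length n w =
     (LEAST k. \<exists>is. length is = k \<and> set is \<subseteq> {1..<n} \<and> perm_of_word is = w)"

text \<open>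
  Bruhat order is the reflexive transitive closure of \<open>u \<rightarrow> u t\<close>, where \<open>t\<close> is a reflection of the
  Coxeter group (that is, an arbitrary transposition) and the length increases.
\<close>

definition bruhat_step :: "nat \<Rightarrow> (nat \<Rightarrow> nat) \<Rightarrow> (nat \<Rightarrow> nat) \<Rightarrow> bool" where
  "bruhat_step n u w \<longleftrightarrow> u permutes {1..n} \<and>
     (\<exists>a b. 1 \<le> a \<and> a < b \<and> b \<le> n \<and> w = u \<circ> Transposition.transpose a b \<and>
            coxeter_length n u < coxeter_length n w)"

definition bruhat_le :: "nat \<Rightarrow> (nat \<Rightarrow> nat) \<Rightarrow> (nat \<Rightarrow> nat) \<Rightarrow> bool" where
  "bruhat_le n = (bruhat_step n)\<^sup>*\<^sup>*"

text \<open>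
  A partition is the list of its positive parts, so its length is the number of rows of the
  Young diagram. Rows (from the top) and columns (from the left) are numbered from 0.
\<close>

definition is_partition :: "nat \<Rightarrow> nat list \<Rightarrow> bool" where
  "is_partition n lam \<longleftrightarrow> sorted_wrt (\<ge>) lam \<and> (\<forall>x\<in>set lam. 0 < x) \<and> sum_list lam = n"

definition boxes :: "nat list \<Rightarrow> (nat \<times> nat) set" where
  "boxes lam = {(i, j). i < length lam \<and> j < lam ! i}"

text \<open>The values of a tableau \<open>T\<close> outside the boxes of its shape are irrelevant.\<close>

definition row_strict_tableau :: "nat \<Rightarrow> nat list \<Rightarrow> (nat \<times> nat \<Rightarrow> nat) \<Rightarrow> bool" where
  "row_strict_tableau n lam T \<longleftrightarrow> bij_betw T (boxes lam) {1..n} \<and>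
     (\<forall>i j k. (i, j) \<in> boxes lam \<and> (i, k) \<in> boxes lam \<and> j < k \<longrightarrow> T (i, j) < T (i, k))"

definition springer_pairs :: "nat \<Rightarrow> nat list \<Rightarrow> (nat \<times> nat \<Rightarrow> nat) \<Rightarrow> (nat \<times> nat) set" where
  "springer_pairs n lam T = {(p, q). 1 \<le> p \<and> p < q \<and> q \<le> n \<and>
     (\<exists>i j i' j'. (i, j) \<in> boxes lam \<and> T (i, j) = p \<and> (i', j') \<in> boxes lam \<and> T (i', j') = q \<and>
        (j' = j \<and> i < i' \<or> j' < j) \<and>
        ((i, Suc j) \<in> boxes lam \<longrightarrow> q < T (i, Suc j)))}"

definition springer_count :: "nat \<Rightarrow> nat list \<Rightarrow> (nat \<times> nat \<Rightarrow> nat) \<Rightarrow> nat \<Rightarrow> nat" where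
  "springer_count n lam T q = card {p. (p, q) \<in> springer_pairs n lam T}"

text \<open>
  With \<open>l\<close> the number of pairs \<open>(p, q)\<close>, \<open>schubert_factor n lam T q\<close> is the factor
  \<open>s_{q-l} s_{q-l+1} \<cdots> s_{q-1}\<close>, carrying index \<open>q - 1\<close> in the Schubert point. For \<open>l = 0\<close> the word
  \<open>[q - l..<q]\<close> is empty and the factor is the identity. Truncated subtraction is harmless, since
  \<open>p < q\<close> and \<open>p \<ge> 1\<close> force \<open>l \<le> q - 1\<close> for \<open>q \<ge> 1\<close>.
\<close>

definition schubert_factor :: "nat \<Rightarrow> nat list \<Rightarrow> (nat \<times> nat \<Rightarrow> nat) \<Rightarrow> nat \<Rightarrow> nat \<Rightarrow> nat" where
  "schubert_factor n lam T q = perm_of_word [q - springer_count n lam T q..<q]"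

text \<open>The factors are multiplied with \<open>q = n\<close> leftmost and \<open>q = 2\<close> rightmost.\<close>

definition schubert_perm :: "nat \<Rightarrow> nat list \<Rightarrow> (nat \<times> nat \<Rightarrow> nat) \<Rightarrow> nat \<Rightarrow> nat" where
  "schubert_perm n lam T = foldr (\<lambda>q u. schubert_factor n lam T q \<circ> u) (rev [2..<Suc n]) id"

definition is_schubert_point :: "nat \<Rightarrow> nat list \<Rightarrow> (nat \<Rightarrow> nat) \<Rightarrow> bool" where
  "is_schubert_point n lam w \<longleftrightarrow> (\<exists>T. row_strict_tableau n lam T \<and> w = schubert_perm n lam T)"

end

theory Submission
  imports Defs
begin

text \<open>
  Reading a tableau from its largest entry downwards, \<open>\<ell>\<^sub>q\<^sub>-\<^sub>1\<close> is the rank, by length and then from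
  the top, of the row that loses its last box when \<open>q\<close> is removed; it is also the number of \<open>p < q\<close>
  with \<open>w(p) > w(q)\<close> for the Schubert point \<open>w\<close>. So \<open>w\<close> is a Schubert point iff its inversion code
  is a legal sequence of removals, a condition that sees only the column heights of the shape. It
  suffices to treat a Bruhat cover, which exchanges the values at \<open>a < b\<close>; on codes this lowers the
  entry at \<open>b\<close> by \<open>k + 1\<close> and raises the one at \<open>a\<close> by \<open>k\<close>. Legality is monotone for dominance
  order and under lowering code entries, which settles \<open>k = 0\<close>. In general the two removal paths are
  compared between \<open>b\<close> and \<open>a\<close>: with two columns they meet again at \<open>a\<close>, and with three rows
  necessarily \<open>k \<le> 1\<close>, and at \<open>a\<close> the new shape is dominated by the old one.
\<close>

section \<open>Words, cycles and inversion codes\<close>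

definition inv_code :: "(nat \<Rightarrow> nat) \<Rightarrow> nat \<Rightarrow> nat" where
  "inv_code w q = card {p \<in> {1..<q}. w q < w p}"

text \<open>The product defining a Schubert point, for an arbitrary code, as a recursion. It has one
  extra factor, at \<open>q = 1\<close>, which is trivial when \<open>c 1 < 1\<close>.\<close>

fun perm_of_code :: "(nat \<Rightarrow> nat) \<Rightarrow> nat \<Rightarrow> nat \<Rightarrow> nat" where
  "perm_of_code c 0 = id"
| "perm_of_code c (Suc q) = perm_of_word [Suc q - c (Suc q)..<Suc q] \<circ> perm_of_code c q"

lemma perm_of_word_Nil [simp]: "perm_of_word [] = id"
  by (simp add: perm_of_word_def)

lemma perm_of_word_Cons [simp]: "perm_of_word (i # is) = simple_transp i \<circ> perm_of_word is"
  by (simp add: perm_of_word_def)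

lemma perm_of_word_append: "perm_of_word (xs @ ys) = perm_of_word xs \<circ> perm_of_word ys"
  by (induction xs) (auto simp: comp_assoc)

lemma bij_perm_of_word: "bij (perm_of_word is)"
proof (induction "is")
  case Nil
  show ?case by (simp only: perm_of_word_Nil bij_id)
next
  case (Cons i "is")
  then show ?case
    unfolding perm_of_word_Cons simple_transp_def by (intro bij_comp bij_transpose)
qed

lemma perm_of_word_permutes: "set is \<subseteq> {1..<n} \<Longrightarrow> perm_of_word is permutes {1..n}"
  by (induction "is")
    (auto simp: simple_transp_def permutes_id intro!: permutes_compose permutes_swap_id)

lemma perm_of_word_upt:
  assumes "m \<le> q"
  shows "perm_of_word [m..<q] x = (if x = q then m else if m \<le> x \<and> x < q then Suc x else x)"
  using assms
proof (induction q arbitrary: x rule: dec_induct)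
  case base
  then show ?case by simp
next
  case (step q)
  then show ?case
    by (auto simp: perm_of_word_append simple_transp_def transpose_def)
qed

lemma perm_of_word_upt_less_iff:
  assumes "m \<le> q" "x < q" "y < q"
  shows "perm_of_word [m..<q] x < perm_of_word [m..<q] y \<longleftrightarrow> x < y"
  using assms by (auto simp: perm_of_word_upt)

lemma perm_of_word_upt_permutes:
  "l < q \<Longrightarrow> perm_of_word [q - l..<q] permutes {1..q}"
  by (rule perm_of_word_permutes) auto

lemma permutes_le: "u permutes {1..m} \<Longrightarrow> p \<le> m \<Longrightarrow> u p \<le> (m::nat)"
  by (metis atLeastAtMost_iff not_less_eq_eq One_nat_def le0 permutes_in_image permutes_not_in)

text \<open>The cycle preserves the order of all values below \<open>Suc m\<close>, and
  \<open>u\<close> takes positions up to \<open>m\<close> to such values. Prepending the factor for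
  \<open>Suc m\<close> thus leaves the earlier inversions alone.\<close>

lemma inv_code_cycle_comp:
  assumes "u permutes {1..m}" "q \<le> m"
  shows "inv_code (perm_of_word [Suc m - l..<Suc m] \<circ> u) q = inv_code u q"
proof -
  have "perm_of_word [Suc m - l..<Suc m] (u q) < perm_of_word [Suc m - l..<Suc m] (u p)
     \<longleftrightarrow> u q < u p" if "p < q" for p
    using that assms(2) permutes_le[OF assms(1)]
    by (intro perm_of_word_upt_less_iff) (simp_all add: less_Suc_eq_le)
  then have "{p \<in> {1..<q}. perm_of_word [Suc m - l..<Suc m] (u q)
        < perm_of_word [Suc m - l..<Suc m] (u p)} = {p \<in> {1..<q}. u q < u p}"
    by (intro Collect_cong conj_cong refl) (simp only: atLeastLessThan_iff)
  then show ?thesis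
    unfolding inv_code_def comp_apply by (rule arg_cong)
qed

text \<open>Every value above \<open>w (Suc m)\<close> is taken at an earlier position, so the
  inversions at the last position are counted by values.\<close>

lemma inv_code_last:
  assumes "w permutes {1..Suc m}"
  shows "inv_code w (Suc m) = Suc m - w (Suc m)"
proof -
  let ?A = "{p \<in> {1..<Suc m}. w (Suc m) < w p}"
  have "w ` ?A = {w (Suc m)<..Suc m}"
  proof (intro equalityI subsetI)
    fix x assume "x \<in> w ` ?A"
    then obtain p where "p \<in> ?A" "x = w p" by (rule imageE)
    moreover from this have "w p \<le> Suc m" by (intro permutes_le[OF assms]) simp
    ultimately show "x \<in> {w (Suc m)<..Suc m}" by simp
  next
    fix x assume x: "x \<in> {w (Suc m)<..Suc m}"
    then have "x \<in> w ` {1..Suc m}" unfolding permutes_image[OF assms] by simp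
    then obtain p where p: "p \<in> {1..Suc m}" "x = w p" by blast
    with x have "p \<noteq> Suc m" by (cases "p = Suc m") simp_all
    with p x have "p \<in> ?A" by simp
    with p show "x \<in> w ` ?A" by (intro image_eqI)
  qed
  then have "card ?A = card {w (Suc m)<..Suc m}"
    using card_image[OF permutes_inj_on[OF assms], of ?A] by simp
  then show ?thesis
    unfolding inv_code_def by simp
qed

lemma inv_code_less: "1 \<le> q \<Longrightarrow> inv_code w q < q"
proof -
  assume "1 \<le> q"
  have "inv_code w q \<le> card {1..<q}"
    unfolding inv_code_def by (rule card_mono) auto
  with \<open>1 \<le> q\<close> show ?thesis by auto
qed

text \<open>By \<open>inv_code_last\<close> the cycle given by the last code entry agrees with
  \<open>w\<close> at \<open>Suc m\<close>. Cancelling it leaves a permutation that fixes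
  \<open>Suc m\<close>.\<close>

lemma permutes_Suc_decomp:
  assumes "w permutes {1..Suc m}"
  obtains u where "u permutes {1..m}"
    "w = perm_of_word [Suc m - inv_code w (Suc m)..<Suc m] \<circ> u"
proof -
  define f where "f = perm_of_word [Suc m - inv_code w (Suc m)..<Suc m]"
  have f: "f permutes {1..Suc m}"
    unfolding f_def by (intro perm_of_word_upt_permutes inv_code_less) auto
  have "w (Suc m) \<le> Suc m" using permutes_le[OF assms] by simp
  then have "f (Suc m) = w (Suc m)"
    by (simp add: f_def perm_of_word_upt inv_code_last[OF assms] del: upt_Suc)
  then have "(inv f \<circ> w) (Suc m) = Suc m"
    using permutes_inverses[OF f] by (metis comp_apply)
  moreover have "inv f \<circ> w permutes {1..Suc m}"
    using permutes_compose[OF assms permutes_inv[OF f]] .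
  ultimately have "inv f \<circ> w permutes {1..m}"
    using permutes_superset[of "inv f \<circ> w" "{1..Suc m}" "{1..m}"] by (auto simp: le_Suc_eq)
  moreover have "w = f \<circ> (inv f \<circ> w)"
    using permutes_inv_o[OF f] by (simp add: comp_assoc[symmetric])
  ultimately show ?thesis using that unfolding f_def by blast
qed

lemma perm_of_code_cong:
  "(\<And>q. 1 \<le> q \<Longrightarrow> q \<le> n \<Longrightarrow> c q = d q) \<Longrightarrow> perm_of_code c n = perm_of_code d n"
  by (induction n) auto

lemma perm_of_code_inv_code:
  "w permutes {1..n} \<Longrightarrow> perm_of_code (inv_code w) n = w"
proof (induction n arbitrary: w)
  case 0
  then show ?case by simp
next
  case (Suc m)
  obtain u where u: "u permutes {1..m}"
    "w = perm_of_word [Suc m - inv_code w (Suc m)..<Suc m] \<circ> u"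
    using permutes_Suc_decomp[OF Suc.prems] .
  have "inv_code w q = inv_code u q" if "q \<le> m" for q
    using inv_code_cycle_comp[OF u(1) that] u(2) by metis
  then have "perm_of_code (inv_code w) m = perm_of_code (inv_code u) m"
    by (intro perm_of_code_cong) auto
  also have "\<dots> = u" using Suc.IH[OF u(1)] .
  finally show ?case using u(2) by simp
qed

lemma perm_of_code_permutes:
  "(\<And>q. 1 \<le> q \<Longrightarrow> q \<le> n \<Longrightarrow> c q < q) \<Longrightarrow> perm_of_code c n permutes {1..n}"
proof (induction n)
  case 0
  show ?case by (simp only: perm_of_code.simps permutes_id)
next
  case (Suc m)
  then have "perm_of_code c m permutes {1..m}" by auto
  then have "perm_of_code c m permutes {1..Suc m}"
    by (rule permutes_subset) auto
  with Suc.prems[of "Suc m"] show ?case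
    unfolding perm_of_code.simps
    by (intro permutes_compose perm_of_word_upt_permutes) auto
qed

text \<open>With \<open>perm_of_code_inv_code\<close>, this identifies permutations with the codes
  satisfying \<open>c q < q\<close>.\<close>

lemma inv_code_perm_of_code:
  assumes "\<And>q. 1 \<le> q \<Longrightarrow> q \<le> n \<Longrightarrow> c q < q" "1 \<le> q" "q \<le> n"
  shows "inv_code (perm_of_code c n) q = c q"
  using assms
proof (induction n)
  case 0
  then show ?case by simp
next
  case (Suc m)
  have u: "perm_of_code c m permutes {1..m}"
    using Suc.prems by (intro perm_of_code_permutes) auto
  show ?case
  proof (cases "q = Suc m")
    case True
    have w: "perm_of_code c (Suc m) permutes {1..Suc m}"
      by (rule perm_of_code_permutes) (rule Suc.prems)
    have "perm_of_code c m (Suc m) = Suc m"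
      using u by (auto simp: permutes_def)
    then have "perm_of_code c (Suc m) (Suc m) = Suc m - c (Suc m)"
      by (simp add: perm_of_word_upt del: upt_Suc)
    with inv_code_last[OF w] Suc.prems(1)[of "Suc m"] show ?thesis
      unfolding True by linarith
  next
    case False
    then have "q \<le> m" using Suc.prems by simp
    with Suc show ?thesis
      unfolding perm_of_code.simps inv_code_cycle_comp[OF u \<open>q \<le> m\<close>] by simp
  qed
qed

text \<open>Concatenating the words of the cycles gives a word for \<open>w\<close>, so the
  \<open>LEAST\<close> in \<open>coxeter_length\<close> ranges over a nonempty set.\<close>

lemma permutes_imp_word:
  assumes "w permutes {1..n}"
  shows "\<exists>is. set is \<subseteq> {1..<n} \<and> perm_of_word is = w"
  using assms
proof (induction n arbitrary: w)
  case 0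
  then show ?case by (intro exI[of _ "[]"]) simp
next
  case (Suc m)
  obtain u where u: "u permutes {1..m}"
    "w = perm_of_word [Suc m - inv_code w (Suc m)..<Suc m] \<circ> u"
    using permutes_Suc_decomp[OF Suc.prems] .
  obtain "is" where "is": "set is \<subseteq> {1..<m}" "perm_of_word is = u"
    using Suc.IH[OF u(1)] by auto
  have "perm_of_word ([Suc m - inv_code w (Suc m)..<Suc m] @ is) = w"
    using u(2) "is"(2) by (simp only: perm_of_word_append)
  moreover have "set ([Suc m - inv_code w (Suc m)..<Suc m] @ is) \<subseteq> {1..<Suc m}"
    using "is"(1) inv_code_less[of "Suc m" w] by auto
  ultimately show ?case by blast
qed

section \<open>Bruhat steps\<close>

lemma transpose_comp_inj:
  "inj f \<Longrightarrow> Transposition.transpose (f a) (f b) \<circ> f = f \<circ> Transposition.transpose a b"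
  by (auto simp: fun_eq_iff transpose_def inj_eq)

text \<open>The strong exchange condition. The letter to delete is one whose factor turns the pair
  of values at \<open>a\<close>, \<open>b\<close> into an inversion.\<close>

lemma perm_of_word_exchange:
  assumes "a < b" "perm_of_word is b < perm_of_word is a"
  shows "\<exists>js. length js < length is \<and> set js \<subseteq> set is \<and>
           perm_of_word js = perm_of_word is \<circ> Transposition.transpose a b"
  using assms(2)
proof (induction "is")
  case Nil
  with assms(1) show ?case by simp
next
  case (Cons i "is")
  let ?u = "perm_of_word is"
  have inj: "inj ?u" using bij_perm_of_word bij_is_inj by blast
  show ?case
  proof (cases "?u b < ?u a")
    case True
    then obtain js where js: "length js < length is" "set js \<subseteq> set is"
      "perm_of_word js = ?u \<circ> Transposition.transpose a b"
      using Cons.IH by metis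
    show ?thesis
      by (rule exI[of _ "i # js"]) (use js in \<open>auto simp: comp_assoc\<close>)
  next
    case False
    moreover have "?u a \<noteq> ?u b" using inj assms(1) by (auto simp: inj_eq)
    \<comment> \<open>A simple transposition reverses the order of two values only if they are the
      two that it swaps.\<close>
    ultimately have "?u a = i" "?u b = Suc i"
      using Cons.prems by (auto simp: simple_transp_def transpose_def split: if_splits)
    then have "simple_transp i \<circ> ?u = ?u \<circ> Transposition.transpose a b"
      using transpose_comp_inj[OF inj, of a b] by (simp add: simple_transp_def)
    then have "perm_of_word (i # is) \<circ> Transposition.transpose a b = ?u"
      by (simp add: comp_assoc)
    then have "length is < length (i # is) \<and> set is \<subseteq> set (i # is) \<and>
        ?u = perm_of_word (i # is) \<circ> Transposition.transpose a b"
      by (metis length_Cons lessI set_subset_Cons)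
    then show ?thesis by blast
  qed
qed

lemma coxeter_length_transpose_less:
  assumes "u permutes {1..n}" "a < b" "u b < u a"
  shows "coxeter_length n (u \<circ> Transposition.transpose a b) < coxeter_length n u"
proof -
  let ?P = "\<lambda>u k. \<exists>is. length is = k \<and> set is \<subseteq> {1..<n} \<and> perm_of_word is = u"
  have "\<exists>k. ?P u k" using permutes_imp_word[OF assms(1)] by blast
  then have "?P u (coxeter_length n u)"
    unfolding coxeter_length_def by (rule LeastI_ex)
  then obtain "is" where "is": "length is = coxeter_length n u" "set is \<subseteq> {1..<n}"
    "perm_of_word is = u" by auto
  obtain js where js: "length js < length is" "set js \<subseteq> set is"
      "perm_of_word js = u \<circ> Transposition.transpose a b"
    using perm_of_word_exchange[OF assms(2), of "is"] assms(3) "is"(3) by auto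
  then have "?P (u \<circ> Transposition.transpose a b) (length js)"
    using "is"(2) by blast
  then have "coxeter_length n (u \<circ> Transposition.transpose a b) \<le> length js"
    unfolding coxeter_length_def by (rule Least_le)
  with js(1) "is"(1) show ?thesis by simp
qed

text \<open>Swapping an inverted pair shortens a permutation. A swap that lengthens \<open>u\<close>
  therefore acts on a pair in increasing order, which is inverted in \<open>w\<close>.\<close>

lemma bruhat_stepD:
  assumes "bruhat_step n u w"
  obtains a b where "1 \<le> a" "a < b" "b \<le> n" "w b < w a"
    "u = w \<circ> Transposition.transpose a b" "w permutes {1..n}"
proof -
  obtain a b where ab: "1 \<le> a" "a < b" "b \<le> n" "w = u \<circ> Transposition.transpose a b"
    "coxeter_length n u < coxeter_length n w" and u: "u permutes {1..n}"
    using assms unfolding bruhat_step_def by auto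
  have "\<not> u b < u a"
    using coxeter_length_transpose_less[OF u ab(2)] ab(4,5) by auto
  moreover have "u a \<noteq> u b" using permutes_inj[OF u] ab(2) by (auto simp: inj_eq)
  ultimately have "w b < w a" using ab(4) by simp
  moreover have "u = w \<circ> Transposition.transpose a b"
    using ab(4) by (simp add: comp_assoc)
  moreover have "w permutes {1..n}"
    unfolding ab(4) using ab u
    by (intro permutes_compose[OF _ u] permutes_swap_id) auto
  ultimately show ?thesis using that ab by blast
qed

section \<open>Reduction of reflections to covers\<close>

lemma transpose_conj:
  assumes "a \<noteq> p" "p \<noteq> b" "a \<noteq> b"
  shows "Transposition.transpose p b \<circ> Transposition.transpose a p \<circ> Transposition.transpose p b
    = Transposition.transpose a b"
  using assms by (auto simp: fun_eq_iff transpose_def)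

text \<open>If a position \<open>p\<close> between \<open>a\<close> and \<open>b\<close> has a value
  between theirs, the swap splits into three swaps of inverted pairs at smaller distance, which
  allows induction on \<open>b - a\<close>.\<close>

lemma downward_transpose_by_covers:
  fixes P :: "(nat \<Rightarrow> nat) \<Rightarrow> bool"
  assumes cover: "\<And>w a b. w permutes {1..n} \<Longrightarrow> 1 \<le> a \<Longrightarrow> a < b \<Longrightarrow> b \<le> n \<Longrightarrow> w b < w a \<Longrightarrow>
      (\<And>p. a < p \<Longrightarrow> p < b \<Longrightarrow> w p < w b \<or> w a < w p) \<Longrightarrow> P w \<Longrightarrow>
      P (w \<circ> Transposition.transpose a b)"
    and "w permutes {1..n}" "1 \<le> a" "a < b" "b \<le> n" "w b < w a" "P w"
  shows "P (w \<circ> Transposition.transpose a b)"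
  using assms(2-)
proof (induction "b - a" arbitrary: w a b rule: less_induct)
  case less
  show ?case
  proof (cases "\<exists>p. a < p \<and> p < b \<and> w b \<le> w p \<and> w p \<le> w a")
    case False
    then have "w p < w b \<or> w a < w p" if "a < p" "p < b" for p
      using that by (meson not_le)
    then show ?thesis
      by (rule cover[OF less.prems(1-5) _ less.prems(6)])
  next
    case True
    then obtain p where p: "a < p" "p < b" "w b \<le> w p" "w p \<le> w a" by auto
    have "w p \<noteq> w b" "w p \<noteq> w a"
      using permutes_inj[OF less.prems(1)] p by (auto simp: inj_eq)
    with p have lt: "w b < w p" "w p < w a" by auto
    have perm: "u \<circ> Transposition.transpose x y permutes {1..n}"
      if "u permutes {1..n}" "a \<le> x" "x < y" "y \<le> b" for u x y
      using that less.prems by (intro permutes_compose permutes_swap_id) auto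
    \<comment> \<open>At \<open>a\<close>, \<open>p\<close>, \<open>b\<close> the relative order of
      the values runs through 321, 312, 132, 123.\<close>
    define w1 where "w1 = w \<circ> Transposition.transpose p b"
    define w2 where "w2 = w1 \<circ> Transposition.transpose a p"
    have w1: "w1 permutes {1..n}" unfolding w1_def using perm less.prems p by simp
    have w2: "w2 permutes {1..n}" unfolding w2_def using perm w1 p by simp
    have "P w1"
      unfolding w1_def using p less.prems lt by (intro less.hyps) auto
    moreover have "w1 a = w a" "w1 p = w b" "w1 b = w p"
      using p by (auto simp: w1_def transpose_def)
    ultimately have "P w2"
      unfolding w2_def using p less.prems lt w1 by (intro less.hyps) auto
    moreover have "w2 p = w a" "w2 b = w p"
      using p by (auto simp: w1_def w2_def transpose_def)
    ultimately have "P (w2 \<circ> Transposition.transpose p b)"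
      using p less.prems lt w2 by (intro less.hyps) auto
    moreover have "w2 \<circ> Transposition.transpose p b = w \<circ> Transposition.transpose a b"
      unfolding w1_def w2_def using transpose_conj[of a p b] p by (simp add: comp_assoc)
    ultimately show ?thesis by simp
  qed
qed

section \<open>Column heights\<close>

text \<open>
  \<open>N j\<close> is the height of the \<open>j\<close>-th column of the current shape, counted from 1. Among the rows
  ordered by length, the row of rank \<open>c\<close> has length \<open>L\<close> iff \<open>N (L + 1) \<le> c < N L\<close>.
\<close>

fun admissible :: "(nat \<Rightarrow> nat) \<Rightarrow> (nat \<Rightarrow> nat) \<Rightarrow> nat \<Rightarrow> bool" where
  "admissible N c 0 = True"
| "admissible N c (Suc q) = (\<exists>L\<ge>1. N (Suc L) \<le> c (Suc q) \<and> c (Suc q) < N L \<and>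
     admissible (N(L := N L - 1)) c q)"

text \<open>Columns are counted from 1 here, but from 0 in \<open>boxes\<close>. Rows that have
  become empty contribute only to index 0.\<close>

definition column :: "nat list \<Rightarrow> nat \<Rightarrow> nat" where
  "column lam j = card {r. r < length lam \<and> j \<le> lam ! r}"

definition row_rank :: "nat list \<Rightarrow> nat \<Rightarrow> nat" where
  "row_rank lam i =
     card {r. r < length lam \<and> (lam ! i < lam ! r \<or> lam ! r = lam ! i \<and> r < i)}"

lemma admissible_cong:
  "(\<And>q. 1 \<le> q \<Longrightarrow> q \<le> n \<Longrightarrow> c q = d q) \<Longrightarrow> admissible N c n = admissible N d n"
  by (induction n arbitrary: N) (auto simp del: fun_upd_apply)

lemma antimono_column: "antimono (column lam)"
  by (auto intro!: antimonoI card_mono simp: column_def)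

lemma row_rank_eq:
  assumes "i < length lam"
  shows "row_rank lam i = column lam (Suc (lam ! i)) + card {r. r < i \<and> lam ! r = lam ! i}"
proof -
  have "{r. r < length lam \<and> (lam ! i < lam ! r \<or> lam ! r = lam ! i \<and> r < i)}
    = {r. r < length lam \<and> Suc (lam ! i) \<le> lam ! r} \<union> {r. r < i \<and> lam ! r = lam ! i}"
    using assms by auto
  then show ?thesis
    unfolding row_rank_def column_def by (simp add: card_Un_disjoint disjoint_iff)
qed

lemma column_eq:
  "column lam L = column lam (Suc L) + card {r. r < length lam \<and> lam ! r = L}"
proof -
  have "{r. r < length lam \<and> L \<le> lam ! r}
    = {r. r < length lam \<and> Suc L \<le> lam ! r} \<union> {r. r < length lam \<and> lam ! r = L}"
    by auto
  then show ?thesis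
    unfolding column_def by (simp add: card_Un_disjoint disjoint_iff)
qed

lemma row_rank_less:
  assumes "i < length lam"
  shows "row_rank lam i < column lam (lam ! i)"
proof -
  have "card {r. r < i \<and> lam ! r = lam ! i} < card {r. r < length lam \<and> lam ! r = lam ! i}"
    using assms by (intro psubset_card_mono) auto
  then show ?thesis
    using row_rank_eq[OF assms] column_eq[of lam "lam ! i"] by simp
qed

text \<open>The witness is the element with index \<open>m\<close>, counted from 0, in the
  increasing enumeration of \<open>S\<close>.\<close>

lemma ex_card_below:
  fixes S :: "nat set"
  assumes "finite S" "m < card S"
  shows "\<exists>i\<in>S. card {r \<in> S. r < i} = m"
  using assms
proof (induction S rule: finite_linorder_max_induct)
  case empty
  then show ?case by simp
next
  case (insert b S)
  have b: "b \<notin> S" using insert by auto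
  show ?case
  proof (cases "m = card S")
    case True
    have "{r \<in> insert b S. r < b} = S" using insert by auto
    with True show ?thesis by (intro bexI[of _ b]) simp_all
  next
    case False
    then obtain i where i: "i \<in> S" "card {r \<in> S. r < i} = m"
      using insert b by auto
    then have "{r \<in> insert b S. r < i} = {r \<in> S. r < i}" using insert by auto
    with i show ?thesis by (intro bexI[of _ i]) simp_all
  qed
qed

text \<open>Longer rows fill the ranks below \<open>column lam (Suc L)\<close>; the rows of length
  \<open>L\<close>, taken from the top, fill the following ones up to
  \<open>column lam L\<close>.\<close>

lemma ex_row_rank:
  assumes "column lam (Suc L) \<le> c" "c < column lam L"
  obtains i where "i < length lam" "lam ! i = L" "row_rank lam i = c"
proof -
  let ?S = "{r. r < length lam \<and> lam ! r = L}"
  have "c - column lam (Suc L) < card ?S"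
    using assms column_eq[of lam L] by simp
  then obtain i where i: "i \<in> ?S" "card {r \<in> ?S. r < i} = c - column lam (Suc L)"
    using ex_card_below[of ?S] by auto
  have "{r \<in> ?S. r < i} = {r. r < i \<and> lam ! r = lam ! i}" using i(1) by auto
  with i have "row_rank lam i = c"
    using row_rank_eq[of i lam] assms by simp
  with i(1) that show ?thesis by auto
qed

lemma column_update:
  assumes "i < length lam" "0 < lam ! i"
  shows "column (lam[i := lam ! i - 1]) = (column lam)(lam ! i := column lam (lam ! i) - 1)"
proof
  fix j
  let ?A = "{r. r < length lam \<and> j \<le> lam ! r}"
  have "{r. r < length lam \<and> j \<le> lam[i := lam ! i - 1] ! r} = (if j = lam ! i then ?A - {i} else ?A)"
    using assms by (auto simp: nth_list_update)
  then show "column (lam[i := lam ! i - 1]) j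
      = ((column lam)(lam ! i := column lam (lam ! i) - 1)) j"
    using assms by (auto simp: column_def)
qed

section \<open>Tableaux and codes\<close>

lemma boxes_update:
  assumes "i < length lam" "0 < lam ! i"
  shows "boxes lam = insert (i, lam ! i - 1) (boxes (lam[i := lam ! i - 1]))"
    and "(i, lam ! i - 1) \<notin> boxes (lam[i := lam ! i - 1])"
  using assms by (auto simp: boxes_def nth_list_update split: if_splits)

text \<open>Since rows increase, the largest entry ends its row. The remaining row lengths may be
  unsorted, so shapes are treated as arbitrary lists.\<close>

lemma tableau_remove_max:
  assumes T: "row_strict_tableau (Suc m) lam T"
  obtains i where "i < length lam" "0 < lam ! i" "T (i, lam ! i - 1) = Suc m"
    "row_strict_tableau m (lam[i := lam ! i - 1]) T"
proof -
  have bij: "bij_betw T (boxes lam) {1..Suc m}"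
    and strict: "\<And>i j k. (i, j) \<in> boxes lam \<Longrightarrow> (i, k) \<in> boxes lam \<Longrightarrow> j < k \<Longrightarrow> T (i, j) < T (i, k)"
    using T unfolding row_strict_tableau_def by blast+
  obtain i j where ij: "(i, j) \<in> boxes lam" "T (i, j) = Suc m"
  proof -
    have "Suc m \<in> T ` boxes lam" using bij by (simp add: bij_betw_def)
    then show ?thesis using that by auto
  qed
  have i: "i < length lam" "0 < lam ! i" using ij by (auto simp: boxes_def)
  have "j = lam ! i - 1"
  proof (rule ccontr)
    assume "j \<noteq> lam ! i - 1"
    then have box: "(i, Suc j) \<in> boxes lam" using ij by (auto simp: boxes_def)
    then have "T (i, Suc j) \<le> Suc m" using bij by (auto simp: bij_betw_def)
    with strict[OF ij(1) box] ij(2) show False by simp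
  qed
  with ij have last: "T (i, lam ! i - 1) = Suc m" by simp
  have "bij_betw T (boxes (lam[i := lam ! i - 1])) ({1..Suc m} - {Suc m})"
    using bij boxes_update[OF i] last notIn_Un_bij_betw3[of "(i, lam ! i - 1)"
        "boxes (lam[i := lam ! i - 1])" T "{1..Suc m} - {Suc m}"]
    by (simp add: insert_absorb del: Diff_insert)
  moreover have "{1..Suc m} - {Suc m} = {1..m}" by auto
  ultimately have "row_strict_tableau m (lam[i := lam ! i - 1]) T"
    using strict boxes_update(1)[OF i] unfolding row_strict_tableau_def by auto
  with i last that show ?thesis by blast
qed

lemma tableau_add_max:
  assumes i: "i < length lam" "0 < lam ! i"
    and T: "row_strict_tableau m (lam[i := lam ! i - 1]) T"
  shows "row_strict_tableau (Suc m) lam (T((i, lam ! i - 1) := Suc m))"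
proof -
  let ?lam = "lam[i := lam ! i - 1]" and ?x = "(i, lam ! i - 1)"
  have bij: "bij_betw T (boxes ?lam) {1..m}"
    and strict: "\<And>i j k. (i, j) \<in> boxes ?lam \<Longrightarrow> (i, k) \<in> boxes ?lam \<Longrightarrow> j < k \<Longrightarrow> T (i, j) < T (i, k)"
    using T unfolding row_strict_tableau_def by blast+
  note b = boxes_update[OF i]
  have "bij_betw (T(?x := Suc m)) (boxes ?lam) {1..m}"
    using bij b(2) by (subst bij_betw_cong[where g = T]) auto
  then have "bij_betw (T(?x := Suc m)) (boxes lam) (insert (Suc m) {1..m})"
    unfolding b(1) using b(2) notIn_Un_bij_betw[of ?x "boxes ?lam" "T(?x := Suc m)" "{1..m}"]
    by simp
  moreover have "insert (Suc m) {1..m} = {1..Suc m}" by auto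
  moreover have "(T(?x := Suc m)) (r, j) < (T(?x := Suc m)) (r, k)"
    if jk: "(r, j) \<in> boxes lam" "(r, k) \<in> boxes lam" "j < k" for r j k
  proof -
    \<comment> \<open>The new box ends its row, so it cannot be the left one of two boxes in a
      row.\<close>
    have "(r, j) \<noteq> ?x" using jk by (auto simp: boxes_def)
    with jk b(1) have j: "(r, j) \<in> boxes ?lam" by auto
    then have "T (r, j) \<le> m" using bij by (auto simp: bij_betw_def)
    with strict[OF j] jk b(1) \<open>(r, j) \<noteq> ?x\<close> show ?thesis by auto
  qed
  ultimately show ?thesis unfolding row_strict_tableau_def by auto
qed

lemma springer_pairs_cong:
  assumes "\<And>x. x \<in> boxes lam \<Longrightarrow> T x = T' x"
  shows "springer_pairs n lam T = springer_pairs n lam T'"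
proof -
  have "springer_pairs n lam S \<subseteq> springer_pairs n lam S'"
    if "\<And>x. x \<in> boxes lam \<Longrightarrow> S x = S' x" for S S'
  proof (clarify)
    fix p q assume "(p, q) \<in> springer_pairs n lam S"
    then obtain r j r' j' where *: "1 \<le> p" "p < q" "q \<le> n" "(r, j) \<in> boxes lam" "S (r, j) = p"
      "(r', j') \<in> boxes lam" "S (r', j') = q" "j' = j \<and> r < r' \<or> j' < j"
      "(r, Suc j) \<in> boxes lam \<longrightarrow> q < S (r, Suc j)"
      unfolding springer_pairs_def by blast
    then have "S' (r, j) = p" "S' (r', j') = q" "(r, Suc j) \<in> boxes lam \<longrightarrow> q < S' (r, Suc j)"
      using that by auto
    with * show "(p, q) \<in> springer_pairs n lam S'"
      unfolding springer_pairs_def by blast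
  qed
  from this[of T T'] this[of T' T] assms show ?thesis by auto
qed

text \<open>The deleted box can matter for \<open>q \<le> m\<close> only as right neighbour of
  \<open>p\<close>, and there the condition \<open>q < Suc m\<close> holds anyway.\<close>

lemma springer_count_remove_max:
  assumes T: "row_strict_tableau (Suc m) lam T"
    and i: "i < length lam" "0 < lam ! i" and last: "T (i, lam ! i - 1) = Suc m"
    and q: "q \<le> m"
  shows "springer_count (Suc m) lam T q = springer_count m (lam[i := lam ! i - 1]) T q"
proof -
  let ?lam = "lam[i := lam ! i - 1]" and ?x = "(i, lam ! i - 1)"
  note b = boxes_update[OF i]
  have "((p, q) \<in> springer_pairs (Suc m) lam T) = ((p, q) \<in> springer_pairs m ?lam T)" for p
  proof
    assume "(p, q) \<in> springer_pairs (Suc m) lam T"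
    then obtain r j r' j' where *: "1 \<le> p" "p < q" "(r, j) \<in> boxes lam" "T (r, j) = p"
      "(r', j') \<in> boxes lam" "T (r', j') = q" "j' = j \<and> r < r' \<or> j' < j"
      "(r, Suc j) \<in> boxes lam \<longrightarrow> q < T (r, Suc j)"
      unfolding springer_pairs_def by blast
    have "(r, j) \<noteq> ?x" "(r', j') \<noteq> ?x" using * q last by auto
    with * b(1) have "(r, j) \<in> boxes ?lam" "(r', j') \<in> boxes ?lam" by auto
    then show "(p, q) \<in> springer_pairs m ?lam T"
      using * q b(1) unfolding springer_pairs_def by blast
  next
    assume "(p, q) \<in> springer_pairs m ?lam T"
    then obtain r j r' j' where *: "1 \<le> p" "p < q" "(r, j) \<in> boxes ?lam" "T (r, j) = p"
      "(r', j') \<in> boxes ?lam" "T (r', j') = q" "j' = j \<and> r < r' \<or> j' < j"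
      "(r, Suc j) \<in> boxes ?lam \<longrightarrow> q < T (r, Suc j)"
      unfolding springer_pairs_def by blast
    have "(r, Suc j) \<in> boxes lam \<longrightarrow> q < T (r, Suc j)"
      using * b(1) last q by (metis insert_iff less_Suc_eq_le)
    moreover have "(r, j) \<in> boxes lam" "(r', j') \<in> boxes lam" "q \<le> Suc m"
      using * b(1) q by auto
    ultimately show "(p, q) \<in> springer_pairs (Suc m) lam T"
      using * unfolding springer_pairs_def by blast
  qed
  then show ?thesis unfolding springer_count_def by simp
qed

text \<open>No entry exceeds \<open>Suc m\<close>, so \<open>p\<close> must end its row
  \<open>r\<close>. Comparing the columns of the two row ends then says that row \<open>r\<close> is
  longer than row \<open>i\<close>, or equally long and above it.\<close>

lemma springer_count_max:
  assumes T: "row_strict_tableau (Suc m) lam T"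
    and i: "i < length lam" "0 < lam ! i" and last: "T (i, lam ! i - 1) = Suc m"
  shows "springer_count (Suc m) lam T (Suc m) = row_rank lam i"
proof -
  let ?x = "(i, lam ! i - 1)"
  let ?R = "{r. r < length lam \<and> (lam ! i < lam ! r \<or> lam ! r = lam ! i \<and> r < i)}"
  have inj: "inj_on T (boxes lam)" and img: "T ` boxes lam = {1..Suc m}"
    using T unfolding row_strict_tableau_def bij_betw_def by blast+
  have x: "?x \<in> boxes lam" using i by (auto simp: boxes_def)
  have "{p. (p, Suc m) \<in> springer_pairs (Suc m) lam T} = (\<lambda>r. T (r, lam ! r - 1)) ` ?R"
  proof (intro equalityI subsetI)
    fix p assume "p \<in> {p. (p, Suc m) \<in> springer_pairs (Suc m) lam T}"
    then obtain r j r' j' where *: "(r, j) \<in> boxes lam" "T (r, j) = p"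
      "(r', j') \<in> boxes lam" "T (r', j') = Suc m" "j' = j \<and> r < r' \<or> j' < j"
      "(r, Suc j) \<in> boxes lam \<longrightarrow> Suc m < T (r, Suc j)"
      unfolding springer_pairs_def by auto
    have "(r', j') = ?x" using inj_onD[OF inj] * x last by metis
    moreover have "(r, Suc j) \<notin> boxes lam"
      using *(6) img by (metis atLeastAtMost_iff imageI not_less)
    with *(1) have "j = lam ! r - 1" "r < length lam" "0 < lam ! r" by (auto simp: boxes_def)
    ultimately show "p \<in> (\<lambda>r. T (r, lam ! r - 1)) ` ?R"
      using *(2,5) i by auto
  next
    fix p assume "p \<in> (\<lambda>r. T (r, lam ! r - 1)) ` ?R"
    then obtain r where r: "r < length lam" "lam ! i < lam ! r \<or> lam ! r = lam ! i \<and> r < i"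
      "p = T (r, lam ! r - 1)" by auto
    have box: "(r, lam ! r - 1) \<in> boxes lam" using r i by (auto simp: boxes_def)
    have "(r, lam ! r - 1) \<noteq> ?x" using r by auto
    then have "p \<noteq> Suc m" using inj_onD[OF inj _ box x] r last by metis
    moreover have "p \<in> {1..Suc m}" using box img r(3) by auto
    ultimately have p: "1 \<le> p" "p < Suc m" by auto
    have "(r, Suc (lam ! r - 1)) \<notin> boxes lam" by (auto simp: boxes_def)
    moreover have "lam ! i - 1 = lam ! r - 1 \<and> r < i \<or> lam ! i - 1 < lam ! r - 1"
      using r i by auto
    ultimately have "(p, Suc m) \<in> springer_pairs (Suc m) lam T"
      using p box x last r(3) unfolding springer_pairs_def by blast
    then show "p \<in> {p. (p, Suc m) \<in> springer_pairs (Suc m) lam T}" by simp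
  qed
  moreover have "inj_on (\<lambda>r. T (r, lam ! r - 1)) ?R"
  proof (rule inj_onI)
    fix r s assume rs: "r \<in> ?R" "s \<in> ?R" "T (r, lam ! r - 1) = T (s, lam ! s - 1)"
    then have "(r, lam ! r - 1) \<in> boxes lam" "(s, lam ! s - 1) \<in> boxes lam"
      using i by (auto simp: boxes_def)
    with inj_onD[OF inj rs(3)] show "r = s" by auto
  qed
  ultimately show ?thesis
    unfolding springer_count_def row_rank_def by (simp add: card_image)
qed

lemma springer_count_admissible:
  "row_strict_tableau n lam T \<Longrightarrow> admissible (column lam) (springer_count n lam T) n"
proof (induction n arbitrary: lam)
  case 0
  then show ?case by simp
next
  case (Suc m)
  obtain i where i: "i < length lam" "0 < lam ! i" "T (i, lam ! i - 1) = Suc m"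
    "row_strict_tableau m (lam[i := lam ! i - 1]) T"
    using tableau_remove_max[OF Suc.prems] .
  have "admissible (column (lam[i := lam ! i - 1])) (springer_count (Suc m) lam T) m"
    using Suc.IH[OF i(4)] springer_count_remove_max[OF Suc.prems i(1-3)]
    by (subst admissible_cong) auto
  then have "admissible ((column lam)(lam ! i := column lam (lam ! i) - 1))
      (springer_count (Suc m) lam T) m"
    unfolding column_update[OF i(1,2)] .
  moreover have "springer_count (Suc m) lam T (Suc m) = row_rank lam i"
    using springer_count_max[OF Suc.prems i(1-3)] .
  ultimately show ?case
    using row_rank_less[OF i(1)] row_rank_eq[OF i(1)] i(2)
    by (auto intro!: exI[of _ "lam ! i"] simp del: fun_upd_apply)
qed

text \<open>Converse construction: the column \<open>L\<close> supplied by \<open>admissible\<close>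
  fixes the length of a row, the code entry fixes which row of that length, and \<open>Suc m\<close>
  is placed at its end.\<close>

lemma admissible_tableau:
  assumes "sum_list lam = n" "admissible (column lam) c n"
  shows "\<exists>T. row_strict_tableau n lam T \<and> (\<forall>q. 1 \<le> q \<and> q \<le> n \<longrightarrow> springer_count n lam T q = c q)"
  using assms
proof (induction n arbitrary: lam)
  case 0
  then have "\<forall>i<length lam. lam ! i = 0" by simp
  then have "boxes lam = {}" by (auto simp: boxes_def)
  then show ?case by (auto simp: row_strict_tableau_def bij_betw_def)
next
  case (Suc m)
  then obtain L where L: "L \<ge> 1" "column lam (Suc L) \<le> c (Suc m)" "c (Suc m) < column lam L"
    "admissible ((column lam)(L := column lam L - 1)) c m"
    by (auto simp del: fun_upd_apply)
  obtain i where i: "i < length lam" "lam ! i = L" "row_rank lam i = c (Suc m)"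
    using ex_row_rank[OF L(2,3)] .
  have i0: "0 < lam ! i" using i L by simp
  let ?lam = "lam[i := lam ! i - 1]"
  have "sum_list ?lam = m"
    using i i0 Suc.prems(1) by (simp add: sum_list_update)
  moreover have "admissible (column ?lam) c m"
    using L(4) i column_update[OF i(1) i0] by simp
  ultimately obtain T where T: "row_strict_tableau m ?lam T"
    "\<And>q. 1 \<le> q \<Longrightarrow> q \<le> m \<Longrightarrow> springer_count m ?lam T q = c q"
    using Suc.IH by blast
  define T' where "T' = T((i, lam ! i - 1) := Suc m)"
  have T': "row_strict_tableau (Suc m) lam T'"
    unfolding T'_def using tableau_add_max[OF i(1) i0 T(1)] .
  have last: "T' (i, lam ! i - 1) = Suc m" by (simp add: T'_def)
  have eq: "T' x = T x" if "x \<in> boxes ?lam" for x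
    using that boxes_update(2)[OF i(1) i0] by (auto simp: T'_def)
  have "springer_pairs m ?lam T' = springer_pairs m ?lam T"
    using eq by (intro springer_pairs_cong)
  then have "springer_count m ?lam T' = springer_count m ?lam T"
    by (simp add: springer_count_def fun_eq_iff)
  then have "springer_count (Suc m) lam T' q = c q" if "1 \<le> q" "q \<le> Suc m" for q
    using that springer_count_max[OF T' i(1) i0 last] i(3) T(2)
      springer_count_remove_max[OF T' i(1) i0 last, of q]
    by (cases "q = Suc m") auto
  with T' show ?case by blast
qed

lemma springer_count_less:
  assumes "1 \<le> q"
  shows "springer_count n lam T q < q"
proof -
  have "springer_count n lam T q \<le> card {1..<q}"
    unfolding springer_count_def by (rule card_mono) (auto simp: springer_pairs_def)
  with assms show ?thesis by simp
qed

lemma schubert_perm_eq: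
  "schubert_perm n lam T = perm_of_code (springer_count n lam T) n"
proof -
  let ?f = "\<lambda>q u. schubert_factor n lam T q \<circ> u"
  have "foldr ?f (rev [2..<Suc k]) id = perm_of_code (springer_count n lam T) k" for k
  proof (induction k)
    case 0
    then show ?case by simp
  next
    case (Suc k)
    show ?case
    proof (cases k)
      case 0
      \<comment> \<open>The factor for \<open>q = 1\<close>, present in \<open>perm_of_code\<close>
        but not in \<open>schubert_perm\<close>, is the identity.\<close>
      have "springer_count n lam T (Suc 0) = 0"
        using springer_count_less[of "Suc 0" n lam T] by simp
      with 0 show ?thesis by simp
    next
      case (Suc k')
      then have "rev [2..<Suc (Suc k)] = Suc k # rev [2..<Suc k]" by simp
      with Suc.IH show ?thesis by (simp only: foldr_Cons comp_apply perm_of_code.simps schubert_factor_def)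
    qed
  qed
  then show ?thesis unfolding schubert_perm_def by simp
qed

text \<open>From here on tableaux are replaced by column heights and codes.\<close>

lemma is_schubert_point_iff:
  assumes w: "w permutes {1..n}" and "sum_list lam = n"
  shows "is_schubert_point n lam w \<longleftrightarrow> admissible (column lam) (inv_code w) n"
proof
  assume "is_schubert_point n lam w"
  then obtain T where T: "row_strict_tableau n lam T" "w = schubert_perm n lam T"
    unfolding is_schubert_point_def by auto
  have "inv_code w q = springer_count n lam T q" if "1 \<le> q" "q \<le> n" for q
    unfolding T(2) schubert_perm_eq using that springer_count_less
    by (intro inv_code_perm_of_code) auto
  with springer_count_admissible[OF T(1)] show "admissible (column lam) (inv_code w) n"
    by (subst admissible_cong) auto
next
  assume "admissible (column lam) (inv_code w) n"
  then obtain T where T: "row_strict_tableau n lam T"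
    "\<And>q. 1 \<le> q \<Longrightarrow> q \<le> n \<Longrightarrow> springer_count n lam T q = inv_code w q"
    using admissible_tableau[OF assms(2)] by blast
  have "schubert_perm n lam T = perm_of_code (inv_code w) n"
    unfolding schubert_perm_eq by (rule perm_of_code_cong) (rule T(2))
  with T(1) perm_of_code_inv_code[OF w] show "is_schubert_point n lam w"
    unfolding is_schubert_point_def by auto
qed

section \<open>Admissible codes under dominance\<close>

definition heights :: "(nat \<Rightarrow> nat) \<Rightarrow> bool" where
  "heights N \<longleftrightarrow> antimono N \<and> (\<exists>j. N j = 0)"

text \<open>Transposing shapes reverses dominance, so the dominated shape is the one with the larger
  partial sums of column heights.\<close>

definition dominated :: "(nat \<Rightarrow> nat) \<Rightarrow> (nat \<Rightarrow> nat) \<Rightarrow> bool" where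
  "dominated M N \<longleftrightarrow> (\<forall>j. sum N {1..j} \<le> sum M {1..j})"

lemma heights_le: "heights N \<Longrightarrow> i \<le> j \<Longrightarrow> N j \<le> N i"
  by (auto simp: heights_def dest: antimonoD)

lemma heights_step:
  assumes "heights N" "N (Suc L) < N L"
  shows "heights (N(L := N L - 1))"
proof -
  have "(N(L := N L - 1)) j \<le> (N(L := N L - 1)) i" if "i \<le> j" for i j
  proof -
    have "N j \<le> N (Suc L)" if "i = L" "j \<noteq> L"
      using that \<open>i \<le> j\<close> by (intro heights_le[OF assms(1)]) simp
    then show ?thesis
      using heights_le[OF assms(1) \<open>i \<le> j\<close>] assms(2) by auto
  qed
  moreover obtain j where "N j = 0" using assms(1) by (auto simp: heights_def)
  then have "(N(L := N L - 1)) j = 0" using assms(2) by auto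
  ultimately show ?thesis unfolding heights_def antimono_def by blast
qed

text \<open>\<open>M 1\<close> is the number of nonempty rows, and each smaller rank belongs to one
  of them.\<close>

lemma ex_step:
  assumes "heights M" "c < M 1"
  obtains K where "1 \<le> K" "M (Suc K) \<le> c" "c < M K"
proof -
  obtain j where "M j = 0" using assms by (auto simp: heights_def)
  then have "M (Suc j) \<le> c" using heights_le[OF assms(1), of j "Suc j"] by simp
  define K where "K = (LEAST j. M (Suc j) \<le> c)"
  have K: "M (Suc K) \<le> c" unfolding K_def by (rule LeastI) fact
  have "K \<noteq> 0" using K assms(2) by (cases K) auto
  then have "\<not> M (Suc (K - 1)) \<le> c"
    unfolding K_def[symmetric] by (metis K_def not_less_Least diff_less zero_less_one neq0_conv)
  with K \<open>K \<noteq> 0\<close> that[of K] show ?thesis by simp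
qed

lemma step_unique:
  assumes "heights N" "N (Suc L) \<le> c" "c < N L" "N (Suc K) \<le> c" "c < N K"
  shows "K = L"
proof (rule antisym; rule ccontr)
  assume "\<not> K \<le> L" then have "N K \<le> N (Suc L)" by (intro heights_le[OF assms(1)]) simp
  with assms show False by simp
next
  assume "\<not> L \<le> K" then have "N L \<le> N (Suc K)" by (intro heights_le[OF assms(1)]) simp
  with assms show False by simp
qed

lemma sum_step:
  fixes N :: "nat \<Rightarrow> nat"
  assumes "1 \<le> L" "0 < N L"
  shows "sum (N(L := N L - 1)) {1..j} + of_bool (L \<le> j) = sum N {1..j}"
proof (induction j)
  case 0
  with assms show ?case by simp
next
  case (Suc j)
  with assms show ?case by (cases "L = Suc j") (auto simp: not_le)
qed

text \<open>Only \<open>K \<le> j < L\<close> is critical. Equal partial sums at \<open>j\<close>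
  would force \<open>N (Suc j) \<le> M (Suc j)\<close>, hence \<open>c < N L \<le> N (Suc j) \<le> M
  (Suc j) \<le> M (Suc K) \<le> c'\<close>, against \<open>c' \<le> c\<close>.\<close>

lemma dominated_step:
  assumes "heights M" "heights N" "dominated M N" "c' \<le> c"
    and "1 \<le> K" "M (Suc K) \<le> c'" "c' < M K" and "1 \<le> L" "c < N L"
  shows "dominated (M(K := M K - 1)) (N(L := N L - 1))"
  unfolding dominated_def
proof
  fix j
  have le: "sum N {1..i} \<le> sum M {1..i}" for i
    using assms(3) by (simp add: dominated_def)
  have "sum N {1..j} < sum M {1..j}" if "K \<le> j" "\<not> L \<le> j"
  proof (rule ccontr)
    assume "\<not> sum N {1..j} < sum M {1..j}"
    then have "N (Suc j) \<le> M (Suc j)" using le[of "Suc j"] le[of j] by simp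
    moreover have "N L \<le> N (Suc j)" using that by (intro heights_le[OF assms(2)]) simp
    moreover have "M (Suc j) \<le> M (Suc K)" using that by (intro heights_le[OF assms(1)]) simp
    ultimately show False using assms by linarith
  qed
  then show "sum (N(L := N L - 1)) {1..j} \<le> sum (M(K := M K - 1)) {1..j}"
    using le[of j] sum_step[of L N j] sum_step[of K M j] assms
    by (cases "K \<le> j"; cases "L \<le> j") (simp_all del: fun_upd_apply)
qed

text \<open>The dominated shape has at least as many nonempty rows, so the lower rank exists in it,
  and \<open>dominated_step\<close> carries the comparison through each removal.\<close>

lemma admissible_dominated:
  assumes "heights M" "heights N" "dominated M N"
    and "\<And>q. 1 \<le> q \<Longrightarrow> q \<le> n \<Longrightarrow> c' q \<le> c q" "admissible N c n"
  shows "admissible M c' n"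
  using assms
proof (induction n arbitrary: M N)
  case 0
  then show ?case by simp
next
  case (Suc n)
  obtain L where L: "1 \<le> L" "N (Suc L) \<le> c (Suc n)" "c (Suc n) < N L"
    "admissible (N(L := N L - 1)) c n"
    using Suc.prems(5) by (auto simp del: fun_upd_apply)
  have c: "c' (Suc n) \<le> c (Suc n)" using Suc.prems(4) by simp
  have "sum N {1..1} \<le> sum M {1..1}" using Suc.prems(3) unfolding dominated_def by blast
  then have "N 1 \<le> M 1" by simp
  moreover have "N L \<le> N 1" using L(1) by (rule heights_le[OF Suc.prems(2)])
  ultimately have "c' (Suc n) < M 1" using L(3) c by linarith
  then obtain K where K: "1 \<le> K" "M (Suc K) \<le> c' (Suc n)" "c' (Suc n) < M K"
    using ex_step[OF Suc.prems(1)] by blast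
  have "admissible (M(K := M K - 1)) c' n"
  proof (rule Suc.IH)
    show "heights (M(K := M K - 1))" "heights (N(L := N L - 1))"
      using heights_step[OF Suc.prems(1), of K] heights_step[OF Suc.prems(2), of L] K L
      by (simp_all del: fun_upd_apply)
    show "dominated (M(K := M K - 1)) (N(L := N L - 1))"
      using dominated_step[OF Suc.prems(1-3) c K L(1,3)] .
  qed (use Suc.prems(4) L(4) in \<open>auto simp del: fun_upd_apply\<close>)
  with K show ?case by (auto simp del: fun_upd_apply)
qed

section \<open>Comparing two removal paths\<close>

lemma dominated_refl: "dominated N N"
  by (simp add: dominated_def)

text \<open>Above \<open>b\<close> the codes agree and a single path serves both. \<open>Inv\<close>
  is a class of shapes closed under removals.\<close>

lemma admissible_prefix:
  assumes step: "\<And>N L. Inv N \<Longrightarrow> 1 \<le> L \<Longrightarrow> N (Suc L) < N L \<Longrightarrow> Inv (N(L := N L - 1))"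
    and base: "\<And>N. Inv N \<Longrightarrow> admissible N c b \<Longrightarrow> admissible N c' b"
    and eq: "\<And>q. b < q \<Longrightarrow> c' q = c q"
    and "b \<le> n" "Inv N" "admissible N c n"
  shows "admissible N c' n"
  using assms(4-)
proof (induction n arbitrary: N rule: dec_induct)
  case base
  then show ?case using assms(2) by blast
next
  case (step n)
  then obtain L where L: "1 \<le> L" "N (Suc L) \<le> c (Suc n)" "c (Suc n) < N L"
    "admissible (N(L := N L - 1)) c n"
    by (auto simp del: fun_upd_apply)
  then have "admissible (N(L := N L - 1)) c' n"
    using step assms(1)[of N L] by auto
  with L eq[of "Suc n"] step.hyps show ?case by (auto simp del: fun_upd_apply)
qed

text \<open>A simulation argument: \<open>R q\<close> relates the shapes on the two paths once all
  entries above \<open>q\<close> are removed. It is carried down to \<open>a\<close>, where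
  \<open>base\<close> takes over.\<close>

lemma admissible_between:
  assumes step: "\<And>q N M L. a \<le> q \<Longrightarrow> q < d \<Longrightarrow> R (Suc q) N M \<Longrightarrow> 1 \<le> L \<Longrightarrow>
      N (Suc L) \<le> c (Suc q) \<Longrightarrow> c (Suc q) < N L \<Longrightarrow>
      \<exists>K\<ge>1. M (Suc K) \<le> c (Suc q) \<and> c (Suc q) < M K \<and>
        R q (N(L := N L - 1)) (M(K := M K - 1))"
    and base: "\<And>N M. R a N M \<Longrightarrow> admissible N c a \<Longrightarrow> admissible M c' a"
    and eq: "\<And>q. a < q \<Longrightarrow> q \<le> d \<Longrightarrow> c' q = c q"
    and "a \<le> q" "q \<le> d" "R q N M" "admissible N c q"
  shows "admissible M c' q"
  using assms(4-)
proof (induction q arbitrary: N M rule: dec_induct)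
  case base
  then show ?case using assms(2) by blast
next
  case (step q)
  then obtain L where L: "1 \<le> L" "N (Suc L) \<le> c (Suc q)" "c (Suc q) < N L"
    "admissible (N(L := N L - 1)) c q"
    by (auto simp del: fun_upd_apply)
  obtain K where K: "1 \<le> K" "M (Suc K) \<le> c (Suc q)" "c (Suc q) < M K"
    "R q (N(L := N L - 1)) (M(K := M K - 1))"
    using assms(1)[OF step.hyps(1) _ step.prems(2) L(1-3)] step.prems(1) by auto
  have "admissible (M(K := M K - 1)) c' q"
    using step.IH[OF _ K(4) L(4)] step.prems(1) by (simp del: fun_upd_apply)
  with K eq[of "Suc q"] step show ?case by (auto simp del: fun_upd_apply)
qed

section \<open>Bruhat covers on codes\<close>

text \<open>
  The effect on the inversion code of a cover that swaps the values at positions \<open>a\<close> and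
  \<open>Suc d\<close>. Here \<open>k\<close> counts the earlier positions with a value between the two, and \<open>G q\<close> the
  positions in \<open>{a<..q}\<close> with a value above both.
\<close>

locale code_move =
  fixes c c' :: "nat \<Rightarrow> nat" and a d h k :: nat and G :: "nat \<Rightarrow> nat"
  assumes a: "1 \<le> a" "a \<le> d" and G_a: "G a = 0"
    and c_a: "c a = h" and c'_a: "c' a = h + k"
    and c_d: "c (Suc d) = h + k + 1 + G d" and c'_d: "c' (Suc d) = h + G d"
    and c'_eq: "q \<noteq> a \<Longrightarrow> q \<noteq> Suc d \<Longrightarrow> c' q = c q"
    and between: "a \<le> q \<Longrightarrow> q < d \<Longrightarrow>
      G (Suc q) = G q \<and> h + k + 1 + G q \<le> c (Suc q) \<or>
      G (Suc q) = Suc (G q) \<and> c (Suc q) \<le> h + G q"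

text \<open>Lowering the value at \<open>a\<close> adds the \<open>k\<close> positions with a value
  in between; raising the one at \<open>b\<close> loses these and \<open>a\<close> itself. In a
  cover, every position from \<open>a\<close> to \<open>b\<close> has its value below both or above
  both, which yields the two alternatives in \<open>between\<close>.\<close>

lemma cover_code_move:
  assumes w: "w permutes {1..n}" and ab: "1 \<le> a" "a < b" "w b < w a"
    and cover: "\<And>p. a < p \<Longrightarrow> p < b \<Longrightarrow> w p < w b \<or> w a < w p"
  shows "code_move (inv_code w) (inv_code (w \<circ> Transposition.transpose a b)) a (b - 1)
    (inv_code w a) (card {p \<in> {1..<a}. w b < w p \<and> w p < w a})
    (\<lambda>q. card {p \<in> {a<..q}. w a < w p})"
proof -
  let ?v = "w \<circ> Transposition.transpose a b"
  let ?H = "{p \<in> {1..<a}. w a < w p}" and ?K = "{p \<in> {1..<a}. w b < w p \<and> w p < w a}"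
    and ?G = "\<lambda>q. {p \<in> {a<..q}. w a < w p}"
  have va: "?v a = w b" and vb: "?v b = w a" and vo: "\<And>p. p \<noteq> a \<Longrightarrow> p \<noteq> b \<Longrightarrow> ?v p = w p"
    by auto
  have neq: "w p \<noteq> w q" if "p \<noteq> q" for p q
    using permutes_inj[OF w] that by (auto simp: inj_eq)
  have h: "inv_code w a = card ?H" by (simp add: inv_code_def)
  have card_HG: "card (?H \<union> ?G q) = card ?H + card (?G q)" for q
    by (intro card_Un_disjoint) auto
  have card_HK: "card (?H \<union> ?K) = card ?H + card ?K"
    by (intro card_Un_disjoint) auto
  have card_HKG: "card (insert a (?H \<union> ?K \<union> ?G q)) = card ?H + card ?K + 1 + card (?G q)" for q
  proof -
    have "card (?H \<union> ?K \<union> ?G q) = card (?H \<union> ?K) + card (?G q)"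
      by (intro card_Un_disjoint) auto
    moreover have "card (insert a (?H \<union> ?K \<union> ?G q)) = Suc (card (?H \<union> ?K \<union> ?G q))"
      by (intro card_insert_disjoint) auto
    ultimately show ?thesis using card_HK by simp
  qed
  show ?thesis
  proof (unfold_locales, unfold h)
    show "1 \<le> a" "a \<le> b - 1" "card (?G a) = 0" "card ?H = card ?H" using ab by auto
    have "{p \<in> {1..<a}. ?v a < ?v p} = ?H \<union> ?K"
    proof (intro equalityI subsetI)
      fix p assume "p \<in> {p \<in> {1..<a}. ?v a < ?v p}"
      with vo[of p] ab va neq[of p a] show "p \<in> ?H \<union> ?K" by auto
    next
      fix p assume "p \<in> ?H \<union> ?K"
      with vo[of p] ab va show "p \<in> {p \<in> {1..<a}. ?v a < ?v p}" by auto
    qed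
    then show "inv_code ?v a = card ?H + card ?K"
      unfolding inv_code_def using card_HK by simp
    have "{p \<in> {1..<b}. w b < w p} = insert a (?H \<union> ?K \<union> ?G (b - 1))"
    proof (intro equalityI subsetI)
      fix p assume p: "p \<in> {p \<in> {1..<b}. w b < w p}"
      consider "p = a" | "p < a" | "a < p" by linarith
      then show "p \<in> insert a (?H \<union> ?K \<union> ?G (b - 1))"
        using p neq[of p a] cover[of p] by cases auto
    next
      fix p assume "p \<in> insert a (?H \<union> ?K \<union> ?G (b - 1))"
      with ab show "p \<in> {p \<in> {1..<b}. w b < w p}" by auto
    qed
    then show "inv_code w (Suc (b - 1)) = card ?H + card ?K + 1 + card (?G (b - 1))"
      unfolding inv_code_def using card_HKG ab by simp
    have "{p \<in> {1..<b}. ?v b < ?v p} = ?H \<union> ?G (b - 1)"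
    proof (intro equalityI subsetI)
      fix p assume p: "p \<in> {p \<in> {1..<b}. ?v b < ?v p}"
      then have "p \<noteq> a" using va vb ab by auto
      with p vo[of p] vb show "p \<in> ?H \<union> ?G (b - 1)" by auto
    next
      fix p assume "p \<in> ?H \<union> ?G (b - 1)"
      with vo[of p] ab vb show "p \<in> {p \<in> {1..<b}. ?v b < ?v p}" by auto
    qed
    then show "inv_code ?v (Suc (b - 1)) = card ?H + card (?G (b - 1))"
      unfolding inv_code_def using card_HG ab by simp
  next
    fix q assume q: "q \<noteq> a" "q \<noteq> Suc (b - 1)"
    then have qb: "q \<noteq> b" using ab by simp
    have vq: "?v q = w q" using vo q qb by blast
    show "inv_code ?v q = inv_code w q"
    proof (cases "b < q")
      case True
      let ?t = "Transposition.transpose a b"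
      \<comment> \<open>Beyond \<open>b\<close> the swap permutes the earlier positions, so it
        matches the two sets of inversions.\<close>
      have t: "?t p \<in> {1..<q}" if "p \<in> {1..<q}" for p
        using that ab True by (auto simp: transpose_def)
      have "{p \<in> {1..<q}. ?v q < ?v p} = ?t ` {p \<in> {1..<q}. w q < w p}"
      proof (intro equalityI subsetI)
        fix p assume "p \<in> {p \<in> {1..<q}. ?v q < ?v p}"
        then have "?t p \<in> {p \<in> {1..<q}. w q < w p}" using vq t[of p] by simp
        then show "p \<in> ?t ` {p \<in> {1..<q}. w q < w p}" by (intro image_eqI[of _ _ "?t p"]) simp_all
      next
        fix p assume "p \<in> ?t ` {p \<in> {1..<q}. w q < w p}"
        then obtain r where "p = ?t r" "r \<in> {1..<q}" "w q < w r" by blast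
        then show "p \<in> {p \<in> {1..<q}. ?v q < ?v p}" using vq t[of r] by simp
      qed
      then show ?thesis
        unfolding inv_code_def by (simp add: card_image)
    next
      case False
      \<comment> \<open>Here \<open>q < b\<close>, so \<open>a\<close> is the only earlier position
        whose value can change, and \<open>w q\<close> does not lie between its old and new
        values.\<close>
      have "(w q < ?v p) = (w q < w p)" if "p < q" for p
      proof (cases "p = a")
        case True
        with that False qb cover[of q] ab va show ?thesis by auto
      next
        case False
        with that \<open>\<not> b < q\<close> vo[of p] show ?thesis by auto
      qed
      then have "{p \<in> {1..<q}. ?v q < ?v p} = {p \<in> {1..<q}. w q < w p}"
        unfolding vq by auto
      then show ?thesis unfolding inv_code_def by simp
    qed
  next
    fix q assume q: "a \<le> q" "q < b - 1"
    have G_Suc: "?G (Suc q) = (if w a < w (Suc q) then insert (Suc q) (?G q) else ?G q)"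
      using q by (auto simp: le_Suc_eq)
    consider "w (Suc q) < w b" | "w a < w (Suc q)" using cover[of "Suc q"] q by fastforce
    then show "card (?G (Suc q)) = card (?G q) \<and>
        card ?H + card ?K + 1 + card (?G q) \<le> inv_code w (Suc q) \<or>
      card (?G (Suc q)) = Suc (card (?G q)) \<and> inv_code w (Suc q) \<le> card ?H + card (?G q)"
    proof cases
      case 1
      then have "insert a (?H \<union> ?K \<union> ?G q) \<subseteq> {p \<in> {1..<Suc q}. w (Suc q) < w p}"
        using ab q by auto
      then have "card (insert a (?H \<union> ?K \<union> ?G q)) \<le> inv_code w (Suc q)"
        unfolding inv_code_def by (intro card_mono) simp_all
      moreover have "\<not> w a < w (Suc q)" using 1 ab by simp
      ultimately show ?thesis unfolding G_Suc card_HKG by simp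
    next
      case 2
      have "{p \<in> {1..<Suc q}. w (Suc q) < w p} \<subseteq> ?H \<union> ?G q"
      proof
        fix p assume p: "p \<in> {p \<in> {1..<Suc q}. w (Suc q) < w p}"
        with 2 have "p \<noteq> a" by auto
        with p 2 show "p \<in> ?H \<union> ?G q" by auto
      qed
      then have "inv_code w (Suc q) \<le> card (?H \<union> ?G q)"
        unfolding inv_code_def by (intro card_mono) auto
      then show ?thesis using 2 unfolding G_Suc card_HG by simp
    qed
  qed
qed

section \<open>At most two columns\<close>

definition two_columns :: "(nat \<Rightarrow> nat) \<Rightarrow> bool" where
  "two_columns N \<longleftrightarrow> heights N \<and> N 3 = 0"

lemma two_columns_step:
  "two_columns N \<Longrightarrow> N (Suc L) < N L \<Longrightarrow> two_columns (N(L := N L - 1))"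
  using heights_step[of N L] by (auto simp: two_columns_def)

lemma two_columns_le: "two_columns N \<Longrightarrow> N 2 \<le> N 1"
  by (simp add: two_columns_def heights_le)

lemma two_columns_cases:
  assumes "two_columns N" "1 \<le> L" "N (Suc L) \<le> c" "c < N L"
  obtains "L = 1" "N 2 \<le> c" "c < N 1" | "L = 2" "c < N 2"
proof -
  have "\<not> 3 \<le> L"
  proof
    assume "3 \<le> L"
    with assms(1) have "N L \<le> N 3" unfolding two_columns_def by (blast intro: heights_le)
    with assms show False by (simp add: two_columns_def)
  qed
  then have "L = 1 \<or> L = 2" using assms(2) by linarith
  then show ?thesis using assms(3,4) that by (auto simp: numeral_2_eq_2)
qed

lemma two_columns_ex:
  assumes "two_columns N"
  shows "c < N 2 \<Longrightarrow> N (Suc 2) \<le> c" "N 2 \<le> c \<Longrightarrow> N (Suc 1) \<le> c"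
  using assms by (auto simp: two_columns_def numeral_2_eq_2 numeral_3_eq_3)

context code_move
begin

text \<open>
  Either both paths agree (and will remove from the same column at \<open>a\<close>, whatever the choice of
  code \<open>h\<close> or \<open>h + k\<close>), or they differ by one box that \<open>N\<close> has in the second and \<open>M\<close> in
  the first column, and this is repaired exactly at \<open>a\<close>.
\<close>

definition two_columns_rel :: "nat \<Rightarrow> (nat \<Rightarrow> nat) \<Rightarrow> (nat \<Rightarrow> nat) \<Rightarrow> bool" where
  "two_columns_rel q N M \<longleftrightarrow> two_columns N \<and> two_columns M \<and> h + k + 1 + G q \<le> N 1 \<and>
     (M = N \<and> (h + k + 1 + G q \<le> N 2 \<or> N 2 \<le> h + G q) \<or>
      M = N(1 := Suc (N 1), 2 := N 2 - 1) \<and> h + G q < N 2 \<and> N 2 \<le> h + k + 1 + G q)"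

text \<open>The same column works for both shapes. If they differ, an entry of at least
  \<open>h + k + 1 + G q\<close> hits the first column in both; an entry of at most
  \<open>h + G q\<close> hits the second, and then \<open>G\<close> and the second columns drop by
  one together.\<close>

lemma two_columns_rel_step:
  assumes q: "a \<le> q" "q < d" and R: "two_columns_rel (Suc q) N M"
    and L: "1 \<le> L" "N (Suc L) \<le> c (Suc q)" "c (Suc q) < N L"
  shows "\<exists>K\<ge>1. M (Suc K) \<le> c (Suc q) \<and> c (Suc q) < M K \<and>
    two_columns_rel q (N(L := N L - 1)) (M(K := M K - 1))"
proof (intro exI conjI)
  have N: "two_columns N" and M: "two_columns M" using R by (auto simp: two_columns_rel_def)
  show "1 \<le> L" by fact
  have stepM: "M (Suc L) \<le> c (Suc q) \<and> c (Suc q) < M L"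
    using N L
  proof (cases rule: two_columns_cases)
    case 1
    with R between[OF q] show ?thesis
      by (auto simp: two_columns_rel_def numeral_2_eq_2)
  next
    case 2
    with R between[OF q] two_columns_ex(1)[OF M] show ?thesis
      by (auto simp: two_columns_rel_def)
  qed
  then show "M (Suc L) \<le> c (Suc q)" "c (Suc q) < M L" by auto
  have "two_columns (N(L := N L - 1))" "two_columns (M(L := M L - 1))"
    using two_columns_step[OF N, of L] two_columns_step[OF M, of L] L stepM
    by (simp_all del: fun_upd_apply)
  with N L show "two_columns_rel q (N(L := N L - 1)) (M(L := M L - 1))"
  proof (cases rule: two_columns_cases)
    case 1
    with R between[OF q] \<open>two_columns (N(L := N L - 1))\<close> \<open>two_columns (M(L := M L - 1))\<close>
    show ?thesis by (auto simp: two_columns_rel_def fun_eq_iff)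
  next
    case 2
    with R between[OF q] two_columns_le[OF N] \<open>two_columns (N(L := N L - 1))\<close>
      \<open>two_columns (M(L := M L - 1))\<close>
    show ?thesis by (auto simp: two_columns_rel_def fun_eq_iff)
  qed
qed

text \<open>At \<open>a\<close> the ranks are \<open>h\<close> for \<open>N\<close> and
  \<open>h + k\<close> for \<open>M\<close>. If the shapes differ, \<open>N\<close> loses its
  surplus box in column 2 and \<open>M\<close> its surplus box in column 1, so they become
  equal.\<close>

lemma two_columns_rel_base:
  assumes R: "two_columns_rel a N M" and "admissible N c a"
  shows "admissible M c' a"
proof -
  obtain a' where a': "a = Suc a'" using a by (cases a) auto
  have N: "two_columns N" and M: "two_columns M" using R by (auto simp: two_columns_rel_def)
  obtain L where L: "1 \<le> L" "N (Suc L) \<le> h" "h < N L" "admissible (N(L := N L - 1)) c a'"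
    using assms(2) c_a unfolding a' by (auto simp del: fun_upd_apply)
  have "\<exists>K\<ge>1. M (Suc K) \<le> h + k \<and> h + k < M K \<and> M(K := M K - 1) = N(L := N L - 1)"
    using N L(1-3)
  proof (cases rule: two_columns_cases)
    case 1
    with R G_a show ?thesis
      by (intro exI[of _ L]) (auto simp: two_columns_rel_def numeral_2_eq_2)
  next
    case 2
    show ?thesis
    proof (cases "M = N")
      case True
      \<comment> \<open>This excludes the second disjunct of \<open>two_columns_rel\<close> when
        \<open>M = N\<close>.\<close>
      have "N \<noteq> N(1 := Suc (N 1), 2 := N 2 - 1)"
        by (metis fun_upd_same fun_upd_other n_not_Suc_n one_eq_numeral_iff semiring_norm(83))
      with True 2 R G_a two_columns_ex(1)[OF N] show ?thesis
        by (intro exI[of _ L]) (auto simp: two_columns_rel_def)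
    next
      case False
      with 2 R G_a show ?thesis
        by (intro exI[of _ 1]) (auto simp: two_columns_rel_def numeral_2_eq_2 fun_eq_iff)
    qed
  qed
  then obtain K where K: "1 \<le> K" "M (Suc K) \<le> h + k" "h + k < M K"
    "M(K := M K - 1) = N(L := N L - 1)" by blast
  have "admissible (N(L := N L - 1)) c' a'"
    using L(4) c'_eq a a' by (subst admissible_cong[of _ _ c]) auto
  with K c'_a show ?thesis unfolding a' admissible.simps by metis
qed

text \<open>The lower rank \<open>h + G d\<close> can only move the choice from column 1 to column
  2. If it does, the shapes differ by that box; otherwise they coincide.\<close>

lemma two_columns_rel_start:
  assumes N: "two_columns N" and L: "1 \<le> L" "N (Suc L) \<le> c (Suc d)" "c (Suc d) < N L"
  shows "\<exists>K\<ge>1. N (Suc K) \<le> c' (Suc d) \<and> c' (Suc d) < N K \<and>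
    two_columns_rel d (N(L := N L - 1)) (N(K := N K - 1))"
proof -
  define K :: nat where "K = (if h + G d < N 2 then 2 else 1)"
  have "N 2 \<le> N 1" using two_columns_le[OF N] .
  have NL: "h + k + 1 + G d < N 1"
    using N L by (cases rule: two_columns_cases) (use c_d \<open>N 2 \<le> N 1\<close> in auto)
  have K: "1 \<le> K" "N (Suc K) \<le> h + G d" "h + G d < N K"
    using two_columns_ex[OF N, of "h + G d"] NL by (auto simp: K_def not_less)
  have tc: "two_columns (N(L := N L - 1))" "two_columns (N(K := N K - 1))"
    using two_columns_step[OF N, of L] two_columns_step[OF N, of K] L K
    by (simp_all del: fun_upd_apply)
  have "two_columns_rel d (N(L := N L - 1)) (N(K := N K - 1))"
    using N L
  proof (cases rule: two_columns_cases)
    case 1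
    with tc NL c_d show ?thesis
      by (auto simp: two_columns_rel_def K_def fun_eq_iff)
  next
    case 2
    with tc NL c_d show ?thesis
      by (auto simp: two_columns_rel_def K_def fun_eq_iff)
  qed
  with K c'_d show ?thesis by auto
qed

lemma admissible_two_columns:
  assumes N: "two_columns N" and "admissible N c (Suc d)"
  shows "admissible N c' (Suc d)"
proof -
  obtain L where L: "1 \<le> L" "N (Suc L) \<le> c (Suc d)" "c (Suc d) < N L"
    "admissible (N(L := N L - 1)) c d"
    using assms(2) by (auto simp del: fun_upd_apply)
  obtain K where K: "1 \<le> K" "N (Suc K) \<le> c' (Suc d)" "c' (Suc d) < N K"
    "two_columns_rel d (N(L := N L - 1)) (N(K := N K - 1))"
    using two_columns_rel_start[OF N L(1-3)] by blast
  have "admissible (N(K := N K - 1)) c' d"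
    by (rule admissible_between[where R = two_columns_rel and a = a and d = d,
          OF two_columns_rel_step two_columns_rel_base _ a(2) order.refl K(4) L(4)])
      (use c'_eq in auto)
  with K show ?thesis by (auto simp del: fun_upd_apply)
qed

end

section \<open>At most three rows\<close>

definition three_rows :: "(nat \<Rightarrow> nat) \<Rightarrow> bool" where
  "three_rows N \<longleftrightarrow> heights N \<and> N 1 \<le> 3"

lemma three_rows_step:
  "three_rows N \<Longrightarrow> N (Suc L) < N L \<Longrightarrow> three_rows (N(L := N L - 1))"
  using heights_step[of N L] by (auto simp: three_rows_def)

lemma three_rows_le: "three_rows N \<Longrightarrow> 1 \<le> j \<Longrightarrow> N j \<le> 3"
  unfolding three_rows_def using heights_le[of N 1 j] by simp

text \<open>
  The path of \<open>N\<close> has removed a box of height three from column \<open>u\<close>, that of \<open>M\<close> the last box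
  of the first row, in column \<open>x\<close>.
\<close>

definition three_rows_rel :: "(nat \<Rightarrow> nat) \<Rightarrow> (nat \<Rightarrow> nat) \<Rightarrow> bool" where
  "three_rows_rel N M \<longleftrightarrow> three_rows N \<and> three_rows M \<and>
     (M = N \<and> (\<exists>x\<ge>1. N x = 2 \<and> N (Suc x) = 0) \<or>
      (\<exists>u x. 1 \<le> u \<and> u < x \<and> N u = 2 \<and> 0 < N x \<and> N (Suc x) = 0 \<and>
        (\<forall>j. 1 \<le> j \<and> j < u \<longrightarrow> N j = 3) \<and> M = N(u := 3, x := N x - 1)))"

text \<open>Rank 2 is the shortest row. If the shapes differ, \<open>N\<close> loses its box in
  column \<open>u - 1\<close> and \<open>M\<close> the one in column \<open>u\<close>, so the
  discrepancy moves one column to the left while \<open>x\<close> stays.\<close>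

lemma three_rows_rel_step:
  assumes R: "three_rows_rel N M" and L: "1 \<le> L" "N (Suc L) \<le> 2" "2 < N L"
  shows "\<exists>K\<ge>1. M (Suc K) \<le> 2 \<and> 2 < M K \<and> three_rows_rel (N(L := N L - 1)) (M(K := M K - 1))"
proof -
  have N: "three_rows N" and M: "three_rows M" using R by (auto simp: three_rows_rel_def)
  have hN: "heights N" using N by (simp add: three_rows_def)
  have NL: "N L = 3" using three_rows_le[OF N L(1)] L(3) by simp
  have N': "three_rows (N(L := N L - 1))" using N L by (intro three_rows_step) auto
  from R consider (same) x where "M = N" "x \<ge> 1" "N x = 2" "N (Suc x) = 0"
    | (diff) u x where "1 \<le> u" "u < x" "N u = 2" "0 < N x" "N (Suc x) = 0"
        "\<And>j. 1 \<le> j \<Longrightarrow> j < u \<Longrightarrow> N j = 3" "M = N(u := 3, x := N x - 1)"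
    unfolding three_rows_rel_def by blast
  then show ?thesis
  proof cases
    case same
    have "L < x" using same NL heights_le[OF hN, of x L] by (cases "L < x") auto
    then have "\<exists>x\<ge>1. (N(L := N L - 1)) x = 2 \<and> (N(L := N L - 1)) (Suc x) = 0"
      using same by (intro exI[of _ x]) auto
    with same N' L show ?thesis
      unfolding three_rows_rel_def by (intro exI[of _ L]) blast
  next
    case diff
    have "L < u" using diff NL heights_le[OF hN, of u L] by (cases "L < u") auto
    moreover have "\<not> Suc L < u" using diff(6)[of "Suc L"] L by auto
    ultimately have u: "u = Suc L" by simp
    have "N (Suc u) \<le> 2" using heights_le[OF hN, of u "Suc u"] diff by simp
    then have Mu: "M (Suc u) \<le> 2" "2 < M u" using diff by auto
    then have M': "three_rows (M(u := M u - 1))" using M by (intro three_rows_step) auto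
    let ?N = "N(L := N L - 1)"
    have "M(u := M u - 1) = ?N(L := 3, x := ?N x - 1)"
      using diff u NL by (auto simp: fun_eq_iff)
    moreover have "L < x" "?N L = 2" "0 < ?N x" "?N (Suc x) = 0"
      "\<And>j. 1 \<le> j \<Longrightarrow> j < L \<Longrightarrow> ?N j = 3"
      using diff u NL by auto
    ultimately have "three_rows_rel ?N (M(u := M u - 1))"
      using N' M' L(1) unfolding three_rows_rel_def by blast
    with Mu diff(1) show ?thesis by blast
  qed
qed

text \<open>\<open>N\<close> uses rank 0 and \<open>M\<close> rank 1. For equal shapes the two
  longest rows both end in column \<open>x\<close>, and the same column is hit.\<close>

lemma three_rows_rel_base:
  assumes R: "three_rows_rel N M" and L: "1 \<le> L" "N (Suc L) \<le> 0" "0 < N L"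
  shows "\<exists>K\<ge>1. M (Suc K) \<le> 1 \<and> 1 < M K \<and>
    heights (N(L := N L - 1)) \<and> heights (M(K := M K - 1)) \<and>
    dominated (M(K := M K - 1)) (N(L := N L - 1))"
proof -
  have hN: "heights N" and hM: "heights M"
    using R by (auto simp: three_rows_rel_def three_rows_def)
  have N': "heights (N(L := N L - 1))" using hN L by (intro heights_step) auto
  from R consider (same) x where "M = N" "x \<ge> 1" "N x = 2" "N (Suc x) = 0"
    | (diff) u x where "1 \<le> u" "u < x" "N u = 2" "0 < N x" "N (Suc x) = 0"
        "M = N(u := 3, x := N x - 1)"
    unfolding three_rows_rel_def by blast
  then show ?thesis
  proof cases
    case same
    then have "x = L" using step_unique[OF hN L(2,3), of x] by simp
    with same N' L show ?thesis
      by (intro exI[of _ L]) (auto simp: dominated_refl simp del: fun_upd_apply)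
  next
    case diff
    have x: "x = L" using step_unique[OF hN L(2,3), of x] diff by simp
    have Mu: "M u = 3" using diff by simp
    then have "1 < M 1" using heights_le[OF hM, of 1 u] diff(1) by simp
    then obtain K where K: "1 \<le> K" "M (Suc K) \<le> 1" "1 < M K"
      using ex_step[OF hM] by blast
    have "u \<le> K"
      using heights_le[OF hM, of "Suc K" u] K Mu by (cases "u \<le> K") auto
    have M': "heights (M(K := M K - 1))" using hM K by (intro heights_step) auto
    \<comment> \<open>\<open>B\<close> is the common larger shape: one path has removed boxes from
      columns \<open>u\<close> and \<open>x\<close> of it, the other from \<open>x\<close> and
      \<open>K\<close>. As \<open>u \<le> K\<close>, the second has the larger partial sums.\<close>
    define B where "B = N(u := 3)"
    have B: "N = B(u := B u - 1)" "M = B(x := B x - 1)"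
      using diff by (auto simp: B_def fun_eq_iff)
    have "sum (N(L := N L - 1)) {1..j} \<le> sum (M(K := M K - 1)) {1..j}" for j
    proof -
      have "sum N {1..j} + of_bool (u \<le> j) = sum B {1..j}"
        unfolding B(1) using diff by (intro sum_step) (auto simp: B_def)
      moreover have "sum M {1..j} + of_bool (L \<le> j) = sum B {1..j}"
        unfolding B(2) x[symmetric] using diff by (intro sum_step) (auto simp: B_def)
      moreover have "sum (N(L := N L - 1)) {1..j} + of_bool (L \<le> j) = sum N {1..j}"
        using L by (intro sum_step) auto
      moreover have "sum (M(K := M K - 1)) {1..j} + of_bool (K \<le> j) = sum M {1..j}"
        using K by (intro sum_step) auto
      moreover have "of_bool (K \<le> j) \<le> (of_bool (u \<le> j) :: nat)"
        using \<open>u \<le> K\<close> by auto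
      ultimately show ?thesis by linarith
    qed
    then have "dominated (M(K := M K - 1)) (N(L := N L - 1))"
      unfolding dominated_def by blast
    with K N' M' show ?thesis by blast
  qed
qed

text \<open>Rank 2 removes from column \<open>u = L\<close>, rank 0 from the last nonempty column
  \<open>x\<close>. They agree exactly when all three rows have the same length.\<close>

lemma three_rows_rel_start:
  assumes N: "three_rows N" and L: "1 \<le> L" "N (Suc L) \<le> 2" "2 < N L"
  shows "\<exists>K\<ge>1. N (Suc K) \<le> 0 \<and> 0 < N K \<and> three_rows_rel (N(L := N L - 1)) (N(K := N K - 1))"
proof -
  have hN: "heights N" using N by (simp add: three_rows_def)
  have "0 < N 1" using heights_le[OF hN L(1)] L(3) by simp
  then obtain x where x: "1 \<le> x" "N (Suc x) \<le> 0" "0 < N x" using ex_step[OF hN] by blast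
  have NL: "N L = 3" using three_rows_le[OF N L(1)] L(3) by simp
  have N': "three_rows (N(L := N L - 1))" using N L by (intro three_rows_step) auto
  have M': "three_rows (N(x := N x - 1))" using N x by (intro three_rows_step) auto
  have "three_rows_rel (N(L := N L - 1)) (N(x := N x - 1))"
  proof (cases "x = L")
    case True
    let ?N = "N(L := N L - 1)"
    have "?N L = 2 \<and> ?N (Suc L) = 0" using True x NL by simp
    with True N' L(1) show ?thesis unfolding three_rows_rel_def by blast
  next
    case False
    have "L \<le> x" using heights_le[OF hN, of "Suc x" L] x NL by (cases "L \<le> x") auto
    then have "L < x" using False by simp
    let ?N = "N(L := N L - 1)"
    have "?N j = 3" if "1 \<le> j" "j < L" for j
      using heights_le[OF hN, of j L] three_rows_le[OF N, of j] that NL by simp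
    moreover have "N(x := N x - 1) = ?N(L := 3, x := ?N x - 1)"
      using \<open>L < x\<close> NL by (auto simp: fun_eq_iff)
    moreover have "?N L = 2" "0 < ?N x" "?N (Suc x) = 0" using \<open>L < x\<close> NL x by auto
    ultimately show ?thesis
      using N' M' L(1) \<open>L < x\<close> unfolding three_rows_rel_def by blast
  qed
  with x show ?thesis by blast
qed

context code_move
begin

lemma G_mono: "a \<le> q \<Longrightarrow> q \<le> d \<Longrightarrow> G q \<le> G d"
proof (induction "d - q" arbitrary: q)
  case 0
  then show ?case by simp
next
  case (Suc m)
  then have "q < d" "G (Suc q) \<le> G d" by simp_all
  with between[of q] Suc.prems(1) show ?case by auto
qed

text \<open>
  Codes are at most 2, so for \<open>k > 0\<close> the move turns the word \<open>2 2 \<dots> 2 0\<close> (read from \<open>Suc d\<close>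
  down to \<open>a\<close>) into \<open>0 2 \<dots> 2 1\<close>.
\<close>

lemma admissible_three_rows:
  assumes N: "three_rows N" and adm: "admissible N c (Suc d)"
  shows "admissible N c' (Suc d)"
proof (cases "k = 0")
  case True
  have "c' q \<le> c q" for q
    using c'_eq[of q] c_a c'_a c_d c'_d True by (cases "q = a"; cases "q = Suc d") auto
  with N adm show ?thesis
    by (intro admissible_dominated[of N N _ c' c]) (auto simp: three_rows_def dominated_refl)
next
  case False
  obtain L where L: "1 \<le> L" "N (Suc L) \<le> c (Suc d)" "c (Suc d) < N L"
    "admissible (N(L := N L - 1)) c d"
    using adm by (auto simp del: fun_upd_apply)
  have "c (Suc d) \<le> 2" using L(3) three_rows_le[OF N L(1)] by simp
  then have small: "h = 0" "k = 1" "G d = 0" and c2: "c (Suc d) = 2"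
    using c_d False by auto
  \<comment> \<open>\<open>G d = 0\<close> makes \<open>G\<close> vanish throughout, so only the
    first alternative of \<open>between\<close> remains.\<close>
  have ge2: "2 \<le> c (Suc q)" if "a \<le> q" "q < d" for q
    using between[OF that] G_mono[of "Suc q"] G_mono[of q] that small by auto
  obtain K where K: "1 \<le> K" "N (Suc K) \<le> 0" "0 < N K"
    "three_rows_rel (N(L := N L - 1)) (N(K := N K - 1))"
    using three_rows_rel_start[OF N L(1-3)[unfolded c2]] by blast
  have "admissible (N(K := N K - 1)) c' d"
  proof (rule admissible_between[where R = "\<lambda>_. three_rows_rel" and a = a and d = d and c = c,
          OF _ _ _ a(2) order.refl K(4) L(4)])
    fix q N M L
    assume q: "a \<le> q" "q < d" and R: "three_rows_rel N M"
      and L: "1 \<le> L" "N (Suc L) \<le> c (Suc q)" "c (Suc q) < N L"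
    have "N L \<le> 3" using R L(1) by (auto simp: three_rows_rel_def intro: three_rows_le)
    then have "c (Suc q) = 2" using ge2[OF q] L(3) by simp
    then show "\<exists>K\<ge>1. M (Suc K) \<le> c (Suc q) \<and> c (Suc q) < M K \<and>
        three_rows_rel (N(L := N L - 1)) (M(K := M K - 1))"
      using three_rows_rel_step[OF R] L by simp
  next
    fix N M
    assume R: "three_rows_rel N M" and "admissible N c a"
    obtain a' where a': "a = Suc a'" using a by (cases a) auto
    obtain L where L: "1 \<le> L" "N (Suc L) \<le> 0" "0 < N L" "admissible (N(L := N L - 1)) c a'"
      using \<open>admissible N c a\<close> c_a small unfolding a' by (auto simp del: fun_upd_apply)
    obtain K where K: "1 \<le> K" "M (Suc K) \<le> 1" "1 < M K" "heights (N(L := N L - 1))"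
      "heights (M(K := M K - 1))" "dominated (M(K := M K - 1)) (N(L := N L - 1))"
      using three_rows_rel_base[OF R L(1-3)] by blast
    have "admissible (M(K := M K - 1)) c' a'"
      using c'_eq a a' by (intro admissible_dominated[OF K(5,4,6) _ L(4)]) auto
    with K(1-3) c'_a small show "admissible M c' a"
      unfolding a' by (auto simp del: fun_upd_apply)
  qed (use c'_eq in auto)
  with K(1-3) c'_d small show ?thesis by (auto simp del: fun_upd_apply)
qed

end

section \<open>Covers and chains in Bruhat order\<close>

lemma heights_column: "heights (column lam)"
proof -
  \<comment> \<open>No row is longer than the total number of boxes, so this column is
    empty.\<close>
  have "{r. r < length lam \<and> Suc (sum_list lam) \<le> lam ! r} = {}"
    using member_le_sum_list nth_mem by (auto simp: not_less_eq_eq)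
  then have "column lam (Suc (sum_list lam)) = 0" by (simp only: column_def card.empty)
  with antimono_column show ?thesis unfolding heights_def by blast
qed

lemma is_schubert_point_cover:
  assumes n: "sum_list lam = n" and shape: "length lam \<le> 3 \<or> (\<forall>x\<in>set lam. x \<le> 2)"
    and w: "w permutes {1..n}" and ab: "1 \<le> a" "a < b" "b \<le> n" "w b < w a"
    and cover: "\<And>p. a < p \<Longrightarrow> p < b \<Longrightarrow> w p < w b \<or> w a < w p"
    and "is_schubert_point n lam w"
  shows "is_schubert_point n lam (w \<circ> Transposition.transpose a b)"
proof -
  let ?v = "w \<circ> Transposition.transpose a b"
  have v: "?v permutes {1..n}"
    using ab by (intro permutes_compose[OF _ w] permutes_swap_id) auto
  interpret code_move "inv_code w" "inv_code ?v" a "b - 1" "inv_code w a"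
    "card {p \<in> {1..<a}. w b < w p \<and> w p < w a}" "\<lambda>q. card {p \<in> {a<..q}. w a < w p}"
    by (rule cover_code_move[OF w ab(1,2,4) cover])
  have b: "Suc (b - 1) = b" using ab by simp
  have adm: "admissible (column lam) (inv_code w) n"
    using assms(9) is_schubert_point_iff[OF w n] by simp
  have eq: "inv_code ?v q = inv_code w q" if "b < q" for q
    using c'_eq[of q] that ab by simp
  from shape have "admissible (column lam) (inv_code ?v) n"
  proof
    assume "length lam \<le> 3"
    moreover have "column lam 1 \<le> card {..<length lam}"
      unfolding column_def by (rule card_mono) auto
    ultimately have "column lam 1 \<le> 3" by simp
    then have "three_rows (column lam)" using heights_column by (simp add: three_rows_def)
    then show ?thesis
      by (intro admissible_prefix[where Inv = three_rows and b = b, OF _ _ eq ab(3) _ adm]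
          three_rows_step admissible_three_rows[unfolded b])
  next
    assume "\<forall>x\<in>set lam. x \<le> 2"
    then have "{r. r < length lam \<and> 3 \<le> lam ! r} = {}"
      using nth_mem by fastforce
    then have "column lam 3 = 0" by (simp only: column_def card.empty)
    then have "two_columns (column lam)" using heights_column by (simp add: two_columns_def)
    then show ?thesis
      by (intro admissible_prefix[where Inv = two_columns and b = b, OF _ _ eq ab(3) _ adm]
          two_columns_step admissible_two_columns[unfolded b])
  qed
  then show ?thesis using is_schubert_point_iff[OF v n] by simp
qed

theorem theorem4p4:
  fixes n :: nat and lam :: "nat list" and v w :: "nat \<Rightarrow> nat"
  assumes "is_partition n lam"
    and "length lam \<le> 3 \<or> (\<forall>x\<in>set lam. x \<le> 2)"
    and "w permutes {1..n}" and "is_schubert_point n lam w"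
    and "v permutes {1..n}" and "bruhat_le n v w"
  shows "is_schubert_point n lam v"
proof -
  have n: "sum_list lam = n" using assms(1) by (simp add: is_partition_def)
  have "(bruhat_step n)\<^sup>*\<^sup>* v w" using assms(6) by (simp add: bruhat_le_def)
  then show ?thesis
  \<comment> \<open>The induction descends from \<open>w\<close>: the property passes from the upper
    end \<open>u'\<close> of a step to its lower end \<open>u\<close>.\<close>
  proof (induction rule: converse_rtranclp_induct)
    case base
    show ?case by fact
  next
    case (step u u')
    obtain a b where "1 \<le> a" "a < b" "b \<le> n" "u' b < u' a"
      "u = u' \<circ> Transposition.transpose a b" "u' permutes {1..n}"
      using bruhat_stepD[OF step.hyps(1)] .
    then show ?case
      using downward_transpose_by_covers[of n "is_schubert_point n lam" u' a b]
        is_schubert_point_cover[OF n assms(2)] step.IH by blast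
  qed
qed

end
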